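(* For every integer $d \geq 2$ there exists a constant $n_0 = n_0(d)$ such that every finite set $A \subset \mathbb{R}^d$ with $\dim(A) = d$ and $|A| \geq n_0$ satisfies $$|A - A| \geq \left(2d - 2+\frac{1}{d-1}\right)|A| - (2d^2-4d+3).$$
   Context: For $A \subset \mathbb{R}^d$, $A - A = \{a - a' : a, a' \in A\}$, and $\dim(A)$ denotes the dimension of the affine subspace of $\mathbb{R}^d$ spanned by $A$. *)

theory Defs
  imports "HOL-Analysis.Analysis"
begin

text \<open>The operation \<open>A - A\<close> on sets is set-theoretic difference in HOL, hence a separate name
  for the Minkowski difference.\<close>

definition difference_set :: "'a::minus set \<Rightarrow> 'a set"
  where "difference_set A = {a - a' | a a'. a \<in> A \<and> a' \<in> A}"

end

theory Submission
  imports Defs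
begin

text \<open>Project \<open>A\<close> along a direction \<open>u\<close> and let \<open>P\<^sub>t\<close> be the set of lines in direction \<open>u\<close> that
  contain at least \<open>t\<close> points of \<open>A\<close>. A line in direction \<open>u\<close> over a difference \<open>b - b'\<close> meets \<open>A - A\<close>
  in at least \<open>w b + w b' - 1\<close> points, where \<open>w\<close> counts the points over \<open>b\<close>. Summing in layers, with
  \<open>B = P\<^sub>1\<close> of dimension \<open>k = d - 1\<close>, gives
  \<open>|A - A| \<ge> |B - B| + (\<Sum>t\<ge>2. 2 |P\<^sub>t - P\<^sub>t| + 2 (k - dim P\<^sub>t) |P\<^sub>t|)\<close>. The same inequality, applied by
  induction on the dimension, yields \<open>|B - B| \<ge> k |B| + max 1 ((|B| - 1) / (2 k - 1))\<close> for every finite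
  \<open>B\<close> of dimension \<open>k\<close>; in particular \<open>|B - B| \<ge> (k + 1 / (2 k)) |B|\<close>, strictly unless \<open>|B| = 2 k\<close>.
  Hence each layer contributes at least \<open>(2 k + 1 / k) |P\<^sub>t|\<close>. If \<open>|B| \<le> 2 k\<close> this is the claim. If
  \<open>|B| > 2 k\<close>, no layer attains equality, and the gain is proportional to \<open>|A| - |B|\<close>; this suffices
  as soon as \<open>|B|\<close> is a small multiple of \<open>|A|\<close>. A direction \<open>u\<close> with so few lines exists when \<open>A\<close>
  is large and \<open>|A - A| \<le> K |A|\<close>: by the inequalities of Petridis, Pluennecke and Ruzsa each dilate
  \<open>l A\<close> with \<open>l \<le> N\<close> is covered by boundedly many translates of \<open>X - X\<close> for some \<open>X \<subseteq> A\<close>, so by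
  pigeonhole some \<open>u \<noteq> 0\<close> has \<open>l u \<in> 2 X - 2 X\<close> for all \<open>l \<le> N\<close>, which bounds \<open>A + {0, u, \<dots>, N u}\<close>.\<close>

section \<open>Layers of a difference set\<close>

definition sdiff :: "'a::minus set \<Rightarrow> 'a set \<Rightarrow> 'a set"
  where "sdiff A B = {a - b | a b. a \<in> A \<and> b \<in> B}"

lemma difference_set_eq_sdiff: "difference_set A = sdiff A A"
  by (simp add: difference_set_def sdiff_def)

lemma sdiffI [intro]: "a \<in> A \<Longrightarrow> b \<in> B \<Longrightarrow> a - b \<in> sdiff A B"
  by (auto simp: sdiff_def)

lemma sdiffE [elim]:
  assumes "x \<in> sdiff A B"
  obtains a b where "a \<in> A" "b \<in> B" "x = a - b"
  using assms by (auto simp: sdiff_def)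

lemma sdiff_eq_image: "sdiff A B = (\<lambda>(a, b). a - b) ` (A \<times> B)"
  by (auto simp: sdiff_def image_iff)

lemma finite_sdiff [simp, intro]: "finite A \<Longrightarrow> finite B \<Longrightarrow> finite (sdiff A B)"
  by (simp add: sdiff_eq_image)

lemma sdiff_mono: "A \<subseteq> A' \<Longrightarrow> B \<subseteq> B' \<Longrightarrow> sdiff A B \<subseteq> sdiff A' B'"
  by (auto simp: sdiff_def)

lemma sdiff_empty [simp]: "sdiff A {} = {}" "sdiff {} A = {}"
  by (auto simp: sdiff_def)

definition bidiff :: "'a::minus set \<Rightarrow> 'a set \<Rightarrow> 'a set"
  where "bidiff B Q = sdiff B Q \<union> sdiff Q B"

lemma finite_bidiff [simp, intro]: "finite A \<Longrightarrow> finite B \<Longrightarrow> finite (bidiff A B)"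
  by (simp add: bidiff_def)

lemma aff_dim_insert_notin:
  fixes B :: "'a::euclidean_space set"
  assumes "b \<notin> affine hull B"
  shows "aff_dim (insert b B) = aff_dim B + 1"
  using assms by (simp add: aff_dim_insert)

lemma affine_hull_parallelogram:
  fixes B :: "'a::euclidean_space set"
  assumes "x \<in> B" "y \<in> B" "z \<in> B"
  shows "x + y - z \<in> affine hull B"
proof -
  have "1 *\<^sub>R x + 1 *\<^sub>R y + (-1) *\<^sub>R z \<in> affine hull B"
    by (rule mem_affine_3[OF affine_affine_hull]) (use assms in \<open>auto intro: hull_inc\<close>)
  then show ?thesis by simp
qed

lemma affine_hull_midpoint:
  fixes B :: "'a::euclidean_space set"
  assumes "x \<in> B" "y \<in> B" "b + b = x + y"
  shows "b \<in> affine hull B"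
proof -
  have "(1/2) *\<^sub>R x + (1/2) *\<^sub>R y \<in> affine hull B"
    by (rule mem_affine[OF affine_affine_hull]) (use assms in \<open>auto intro: hull_inc\<close>)
  moreover have "(1/2) *\<^sub>R x + (1/2) *\<^sub>R y = (1/2) *\<^sub>R (b + b)"
    by (simp only: assms scaleR_add_right)
  moreover have "\<dots> = b" by (simp flip: scaleR_2)
  ultimately show ?thesis by simp
qed

text \<open>Every point outside the affine hull of the points added so far contributes the \<open>2 |Q|\<close> new
  differences \<open>\<plusminus>(b - q)\<close>.\<close>

lemma sum_bidiff_ge:
  fixes Q B :: "'a::euclidean_space set" and g v :: "'a \<Rightarrow> real"
  assumes "finite B" "Q \<subseteq> B"
    and "\<And>x. x \<in> bidiff B Q \<Longrightarrow> 0 \<le> g x"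
    and "\<And>b q. b \<in> B \<Longrightarrow> q \<in> Q \<Longrightarrow> v q \<le> g (b - q)"
    and "\<And>b q. b \<in> B \<Longrightarrow> q \<in> Q \<Longrightarrow> v q \<le> g (q - b)"
  shows "2 * real_of_int (aff_dim B - aff_dim Q) * sum v Q \<le> sum g (bidiff B Q - sdiff Q Q)"
proof -
  have finQ: "finite Q" using assms finite_subset by blast
  have "2 * real_of_int (aff_dim (Q \<union> R) - aff_dim Q) * sum v Q
      \<le> sum g (bidiff (Q \<union> R) Q - sdiff Q Q)" if "finite R" "R \<subseteq> B" for R
    using that
  proof (induction R rule: finite_induct)
    case empty
    show ?case by (simp add: bidiff_def)
  next
    case (insert b R)
    let ?B = "Q \<union> R"
    have finB: "finite ?B" using insert finQ by simp
    have sub: "?B \<subseteq> B" using insert assms by auto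
    have IH: "2 * real_of_int (aff_dim ?B - aff_dim Q) * sum v Q
        \<le> sum g (bidiff ?B Q - sdiff Q Q)" using insert by simp
    have gnn: "0 \<le> g x" if "x \<in> bidiff (insert b ?B) Q" for x
    proof -
      have "insert b ?B \<subseteq> B" using sub insert.prems by auto
      then have "bidiff (insert b ?B) Q \<subseteq> bidiff B Q"
        unfolding bidiff_def by (intro Un_mono sdiff_mono) auto
      then show ?thesis using that assms(3) by blast
    qed
    have submono: "bidiff ?B Q \<subseteq> bidiff (insert b ?B) Q"
      unfolding bidiff_def by (intro Un_mono sdiff_mono) auto
    have finS: "finite (bidiff (insert b ?B) Q)" using finB finQ by simp
    show ?case
    proof (cases "b \<in> affine hull ?B")
      case True
      then have "aff_dim (insert b ?B) = aff_dim ?B" by (simp add: aff_dim_insert)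
      moreover have "sum g (bidiff ?B Q - sdiff Q Q) \<le> sum g (bidiff (insert b ?B) Q - sdiff Q Q)"
        by (rule sum_mono2) (use finS submono gnn in auto)
      ultimately show ?thesis using IH by simp
    next
      case False
      define N1 where "N1 = (\<lambda>q. b - q) ` Q"
      define N2 where "N2 = (\<lambda>q. q - b) ` Q"
      have ad: "aff_dim (insert b ?B) = aff_dim ?B + 1" using False by (rule aff_dim_insert_notin)
      have a1: False if "b - q = b' - q'" "b' \<in> ?B" "q \<in> Q" "q' \<in> Q" for q b' q'
      proof -
        have "b = b' + q - q'" using that by (simp add: algebra_simps)
        then show False using affine_hull_parallelogram[of b' ?B q q'] that False by auto
      qed
      have a2: False if "b - q = q' - b'" "b' \<in> ?B" "q \<in> Q" "q' \<in> Q" for q b' q'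
      proof -
        have "b = q' + q - b'" using that by (simp add: algebra_simps)
        then show False using affine_hull_parallelogram[of q' ?B q b'] that False by auto
      qed
      have a3: False if "b - q = q' - b" "q \<in> Q" "q' \<in> Q" for q q'
      proof -
        have "b + b = q + q'" using that by (simp add: algebra_simps)
        then show False using affine_hull_midpoint[of q ?B q' b] that False by auto
      qed
      have d1: "N1 \<inter> bidiff ?B Q = {}"
        unfolding N1_def bidiff_def using a1 a2 by blast
      have d2: "N2 \<inter> bidiff ?B Q = {}"
      proof (rule ccontr)
        assume "\<not> ?thesis"
        then obtain q x where q: "q \<in> Q" "q - b \<in> sdiff ?B Q \<union> sdiff Q ?B"
          unfolding N2_def bidiff_def by blast
        then consider b' q' where "b' \<in> ?B" "q' \<in> Q" "q - b = b' - q'"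
          | b' q' where "b' \<in> ?B" "q' \<in> Q" "q - b = q' - b'" by blast
        then show False
        proof cases
          case 1
          then have "b - q = q' - b'" by (metis minus_diff_eq)
          then show False using a2 1 q by blast
        next
          case 2
          then have "b - q = b' - q'" by (metis minus_diff_eq)
          then show False using a1 2 q by blast
        qed
      qed
      have d3: "N1 \<inter> N2 = {}" unfolding N1_def N2_def using a3 by blast
      have QQ: "sdiff Q Q \<subseteq> bidiff ?B Q" unfolding bidiff_def by (auto simp: sdiff_def)
      have s1: "sum v Q \<le> sum g N1"
      proof -
        have "sum g N1 = (\<Sum>q\<in>Q. g (b - q))" unfolding N1_def
          by (subst sum.reindex) (auto simp: inj_on_def)
        also have "\<dots> \<ge> sum v Q" by (rule sum_mono) (use assms insert.prems in auto)
        finally show ?thesis .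
      qed
      have s2: "sum v Q \<le> sum g N2"
      proof -
        have "sum g N2 = (\<Sum>q\<in>Q. g (q - b))" unfolding N2_def
          by (subst sum.reindex) (auto simp: inj_on_def)
        also have "\<dots> \<ge> sum v Q" by (rule sum_mono) (use assms insert.prems in auto)
        finally show ?thesis .
      qed
      have fN: "finite N1" "finite N2" unfolding N1_def N2_def using finQ by auto
      have "sum g (bidiff ?B Q - sdiff Q Q) + sum g N1 + sum g N2
          = sum g ((bidiff ?B Q - sdiff Q Q) \<union> N1 \<union> N2)"
      proof -
        have "sum g ((bidiff ?B Q - sdiff Q Q) \<union> N1 \<union> N2)
            = sum g ((bidiff ?B Q - sdiff Q Q) \<union> N1) + sum g N2"
          by (rule sum.union_disjoint) (use finB finQ fN d2 d3 in auto)
        moreover have "sum g ((bidiff ?B Q - sdiff Q Q) \<union> N1) = sum g (bidiff ?B Q - sdiff Q Q) + sum g N1"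
          by (rule sum.union_disjoint) (use finB finQ fN d1 in auto)
        ultimately show ?thesis by simp
      qed
      also have "\<dots> \<le> sum g (bidiff (insert b ?B) Q - sdiff Q Q)"
      proof (rule sum_mono2)
        have "N1 \<subseteq> bidiff (insert b ?B) Q" "N2 \<subseteq> bidiff (insert b ?B) Q"
          unfolding N1_def N2_def bidiff_def by auto
        then show "(bidiff ?B Q - sdiff Q Q) \<union> N1 \<union> N2 \<subseteq> bidiff (insert b ?B) Q - sdiff Q Q"
          using submono d1 d2 QQ by blast
      qed (use finS gnn in auto)
      finally have "sum g (bidiff ?B Q - sdiff Q Q) + 2 * sum v Q
          \<le> sum g (bidiff (insert b ?B) Q - sdiff Q Q)" using s1 s2 by linarith
      moreover have "2 * real_of_int (aff_dim (insert b ?B) - aff_dim Q) * sum v Q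
          = 2 * real_of_int (aff_dim ?B - aff_dim Q) * sum v Q + 2 * sum v Q"
        unfolding ad by (simp add: algebra_simps)
      ultimately show ?thesis using IH by simp
    qed
  qed
  from this[of "B"] assms show ?thesis by (simp add: Un_absorb1)
qed

lemma bidiffE:
  assumes "x \<in> bidiff B Q"
  obtains b q where "b \<in> B" "q \<in> Q" "x = b - q" | b q where "b \<in> B" "q \<in> Q" "x = q - b"
  using assms by (auto simp: bidiff_def sdiff_def)

text \<open>The bonus excludes equality in the layer inequality when \<open>Q\<close> is an extremal layer, of the same
  dimension as \<open>B\<close> but different from it.\<close>

definition bonus :: "'a::euclidean_space set \<Rightarrow> 'a set \<Rightarrow> real"
  where "bonus B Q = (if Q \<noteq> B \<and> aff_dim Q = aff_dim B
    \<and> (\<forall>b\<in>B - Q. \<exists>q\<in>Q. b - q \<notin> sdiff Q Q) then 1 else 0)"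

definition level_weight :: "'a::euclidean_space set \<Rightarrow> 'a set \<Rightarrow> real"
  where "level_weight B Q = 2 * real (card (sdiff Q Q))
    + 2 * real_of_int (aff_dim B - aff_dim Q) * real (card Q) + bonus B Q"

definition superlevel :: "('a \<Rightarrow> nat) \<Rightarrow> 'a set \<Rightarrow> nat \<Rightarrow> 'a set"
  where "superlevel w B t = {b\<in>B. t \<le> w b}"

lemma bonus_bounds: "0 \<le> bonus B Q" "bonus B Q \<le> 1"
  by (auto simp: bonus_def)

lemma finite_superlevel [simp, intro]: "finite B \<Longrightarrow> finite (superlevel w B t)"
  by (simp add: superlevel_def)

lemma superlevel_subset: "superlevel w B t \<subseteq> B"
  by (auto simp: superlevel_def)

lemma sum_card_superlevel:
  assumes "finite B" "\<And>b. b \<in> B \<Longrightarrow> w b \<le> T" "\<And>b. b \<in> B \<Longrightarrow> s \<le> w b" 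
  shows "(\<Sum>t\<in>{Suc s..T}. card (superlevel w B t)) = (\<Sum>b\<in>B. w b - s)"
proof -
  have "(\<Sum>t\<in>{Suc s..T}. card (superlevel w B t)) = (\<Sum>t\<in>{Suc s..T}. \<Sum>b\<in>B. if t \<le> w b then 1 else 0)"
    by (intro sum.cong refl) (simp add: superlevel_def assms sum.If_cases Int_def)
  also have "\<dots> = (\<Sum>b\<in>B. \<Sum>t\<in>{Suc s..T}. if t \<le> w b then 1 else 0)" by (rule sum.swap)
  also have "\<dots> = (\<Sum>b\<in>B. w b - s)"
  proof (rule sum.cong[OF refl])
    fix b assume b: "b \<in> B"
    have "{Suc s..T} \<inter> {t. t \<le> w b} = {Suc s..w b}" using assms(2)[OF b] by auto
    then show "(\<Sum>t\<in>{Suc s..T}. if t \<le> w b then 1 else 0) = w b - s"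
      by (simp add: sum.If_cases)
  qed
  finally show ?thesis .
qed

lemma card_bidiff_ge:
  fixes Q B :: "'a::euclidean_space set"
  assumes "finite B" "Q \<subseteq> B"
  shows "level_weight B Q \<le> real (card (bidiff B Q)) + real (card (sdiff Q Q))"
proof -
  have finQ: "finite Q" using assms finite_subset by blast
  have QQ: "sdiff Q Q \<subseteq> bidiff B Q" unfolding bidiff_def using assms by (auto simp: sdiff_def)
  have c: "real (card (bidiff B Q - sdiff Q Q)) = real (card (bidiff B Q)) - real (card (sdiff Q Q))"
    using QQ finQ assms by (simp add: card_Diff_subset card_mono of_nat_diff)
  have 1: "2 * real_of_int (aff_dim B - aff_dim Q) * real (card Q) \<le> real (card (bidiff B Q - sdiff Q Q))"
    using sum_bidiff_ge[of B Q "\<lambda>_. 1" "\<lambda>_. 1"] assms by simp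
  show ?thesis
  proof (cases "bonus B Q = 0")
    case True
    then show ?thesis using 1 c by (simp add: level_weight_def)
  next
    case False
    then have b: "Q \<noteq> B" "aff_dim Q = aff_dim B" "\<forall>b\<in>B - Q. \<exists>q\<in>Q. b - q \<notin> sdiff Q Q" "bonus B Q = 1"
      by (auto simp: bonus_def split: if_splits)
    then obtain b q where "b \<in> B" "q \<in> Q" "b - q \<notin> sdiff Q Q" using assms(2) by blast
    then have "b - q \<in> bidiff B Q - sdiff Q Q" by (auto simp: bidiff_def)
    then have "card (bidiff B Q - sdiff Q Q) \<noteq> 0" using assms finQ by auto
    then show ?thesis using c b by (simp add: level_weight_def)
  qed
qed

lemma sum_fibres_ge_two_levels:
  fixes B :: "'a::euclidean_space set" and w G :: "'a \<Rightarrow> nat"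
  assumes "finite B" "\<And>b. b \<in> B \<Longrightarrow> 1 \<le> w b" "\<And>b. b \<in> B \<Longrightarrow> w b \<le> T"
    and "\<And>b b'. b \<in> B \<Longrightarrow> b' \<in> B \<Longrightarrow> w b + w b' \<le> G (b - b') + 1"
    and IH: "\<And>Q w' G'. Q = superlevel w B 2 \<Longrightarrow> w' = (\<lambda>b. w b - 1) \<Longrightarrow> G' = (\<lambda>x. G x - 2) \<Longrightarrow>
       real (card (sdiff Q Q)) + (\<Sum>t\<in>{2..T-1}. level_weight Q (superlevel w' Q t))
         \<le> (\<Sum>x\<in>sdiff Q Q. real (G' x))"
  shows "real (card (sdiff B B)) + real (card (bidiff B (superlevel w B 2)))
      + real (card (sdiff (superlevel w B 2) (superlevel w B 2)))
      + (\<Sum>t\<in>{3..T}. level_weight B (superlevel w B t)) \<le> (\<Sum>x\<in>sdiff B B. real (G x))"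
proof -
  define Q where "Q = superlevel w B 2"
  define P where "P = superlevel w B"
  have QB: "Q \<subseteq> B" unfolding Q_def by (rule superlevel_subset)
  have fQ: "finite Q" using QB assms finite_subset by blast
  have wQ: "2 \<le> w q" if "q \<in> Q" for q using that by (auto simp: Q_def superlevel_def)
  have GQ: "w b + w b' \<le> G (b - b') + 1" if "b \<in> B" "b' \<in> B" for b b' using assms(4) that by auto
  have lev: "superlevel (\<lambda>b. w b - 1) Q t = P (Suc t)" if "t \<ge> 2" for t
    using that by (auto simp: superlevel_def P_def Q_def)
  have QQ: "sdiff Q Q \<subseteq> bidiff B Q" unfolding bidiff_def using QB by (auto simp: sdiff_def)
  have SB: "bidiff B Q \<subseteq> sdiff B B" unfolding bidiff_def using QB by (auto simp: sdiff_def)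
  have G1: "1 \<le> G x" if "x \<in> sdiff B B" for x
    using that
  proof (rule sdiffE)
    fix a b assume "a \<in> B" "b \<in> B" "x = a - b"
    then show ?thesis using GQ[of a b] assms(2)[of a] assms(2)[of b] by auto
  qed
  have G2: "2 \<le> G x" if "x \<in> bidiff B Q" for x
  proof -
    show ?thesis using that
    proof (cases rule: bidiffE)
      case (1 b q)
      then show ?thesis using GQ[of b q] assms(2)[of b] wQ[of q] QB by auto
    next
      case (2 b q)
      then show ?thesis using GQ[of q b] assms(2)[of b] wQ[of q] QB by auto
    qed
  qed
  have shift: "(\<Sum>t\<in>{2..T-1}. level_weight Q (superlevel (\<lambda>b. w b - 1) Q t)) = (\<Sum>t\<in>{3..T}. level_weight Q (P t))"
  proof -
    have "(\<Sum>t\<in>{3..T}. level_weight Q (P t)) = (\<Sum>t\<in>{2..T-1}. level_weight Q (P (Suc t)))"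
    proof (cases T)
      case (Suc T')
      show ?thesis unfolding Suc
        using sum.shift_bounds_cl_Suc_ivl[of "\<lambda>t. level_weight Q (P t)" 2 T'] by (simp add: numeral_3_eq_3 numeral_2_eq_2)
    qed simp
    also have "\<dots> = (\<Sum>t\<in>{2..T-1}. level_weight Q (superlevel (\<lambda>b. w b - 1) Q t))"
      by (intro sum.cong refl arg_cong[where f = "level_weight Q"]) (use lev in auto)
    finally show ?thesis by simp
  qed
  have IH': "3 * real (card (sdiff Q Q)) + (\<Sum>t\<in>{3..T}. level_weight Q (P t)) \<le> (\<Sum>x\<in>sdiff Q Q. real (G x))"
  proof -
    have "(\<Sum>x\<in>sdiff Q Q. real (G x)) = (\<Sum>x\<in>sdiff Q Q. real (G x - 2) + 2)"
      by (intro sum.cong refl) (use G2 QQ in \<open>force simp: of_nat_diff\<close>)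
    also have "\<dots> = (\<Sum>x\<in>sdiff Q Q. real (G x - 2)) + 2 * real (card (sdiff Q Q))"
      by (simp add: sum.distrib)
    finally show ?thesis using IH[OF Q_def refl refl] shift by simp
  qed
  have EX: "(\<Sum>t\<in>{3..T}. level_weight B (P t)) - (\<Sum>t\<in>{3..T}. level_weight Q (P t))
      \<le> (\<Sum>x\<in>bidiff B Q - sdiff Q Q. real (G x - 2))"
  proof -
    have PQ: "P t \<subseteq> Q" if "t \<in> {3..T}" for t
      using that by (auto simp: P_def Q_def superlevel_def)
    have "Q \<noteq> B \<Longrightarrow> aff_dim Q = aff_dim B \<Longrightarrow> ?thesis"
    proof -
      assume eq: "Q \<noteq> B" "aff_dim Q = aff_dim B"
      have diff: "level_weight B (P t) - level_weight Q (P t) = bonus B (P t) - bonus Q (P t)" for t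
        using eq by (simp add: level_weight_def)
      have mono: "bonus B (P t) \<le> bonus Q (P t)" if "P t \<noteq> Q" "t \<in> {3..T}" for t
        using that eq PQ[of t] QB by (auto simp: bonus_def)
      show ?thesis
      proof (cases "bonus B Q = 1")
        case True
        then have "\<forall>b\<in>B - Q. \<exists>q\<in>Q. b - q \<notin> sdiff Q Q" by (auto simp: bonus_def split: if_splits)
        moreover have "B - Q \<noteq> {}" using eq QB by blast
        ultimately obtain b q where bq: "b \<in> B" "q \<in> Q" "b - q \<notin> sdiff Q Q" by blast
        have "(\<Sum>t\<in>{3..T}. level_weight B (P t)) - (\<Sum>t\<in>{3..T}. level_weight Q (P t))
            = (\<Sum>t\<in>{3..T}. bonus B (P t) - bonus Q (P t))"
          by (simp add: diff flip: sum_subtractf)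
        also have "\<dots> \<le> (\<Sum>t\<in>{3..T}. if P t = Q then 1 else 0)"
          by (intro sum_mono) (use mono bonus_bounds in \<open>force simp: bonus_def\<close>)
        also have "\<dots> = real (card ({3..T} \<inter> {t. P t = Q}))" by (simp add: sum.If_cases)
        also have "\<dots> \<le> real (card {3..w q})"
        proof -
          have "{3..T} \<inter> {t. P t = Q} \<subseteq> {3..w q}" using bq by (auto simp: P_def superlevel_def)
          then show ?thesis by (intro of_nat_mono card_mono) auto
        qed
        also have "\<dots> \<le> real (G (b - q) - 2)"
          using GQ[of b q] bq QB assms(2)[of b] by auto
        also have "\<dots> \<le> (\<Sum>x\<in>bidiff B Q - sdiff Q Q. real (G x - 2))"
          by (rule member_le_sum) (use bq fQ assms in \<open>auto simp: bidiff_def\<close>)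
        finally show ?thesis .
      next
        case False
        then have "bonus B Q = 0" by (auto simp: bonus_def split: if_splits)
        then have "bonus B (P t) \<le> bonus Q (P t)" if "t \<in> {3..T}" for t
          using mono that bonus_bounds by metis
        then have "(\<Sum>t\<in>{3..T}. level_weight B (P t)) - (\<Sum>t\<in>{3..T}. level_weight Q (P t)) \<le> 0"
          using diff by (auto simp flip: sum_subtractf intro!: sum_nonpos)
        also have "\<dots> \<le> (\<Sum>x\<in>bidiff B Q - sdiff Q Q. real (G x - 2))" by (simp add: sum_nonneg)
        finally show ?thesis .
      qed
    qed
    moreover have "aff_dim Q \<noteq> aff_dim B \<Longrightarrow> ?thesis"
    proof -
      assume ne: "aff_dim Q \<noteq> aff_dim B"
      then have lt: "aff_dim Q < aff_dim B" using aff_dim_subset[OF QB] by simp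
      have "(\<Sum>t\<in>{3..T}. level_weight B (P t)) - (\<Sum>t\<in>{3..T}. level_weight Q (P t))
          = (\<Sum>t\<in>{3..T}. level_weight B (P t) - level_weight Q (P t))" by (simp add: sum_subtractf)
      also have "\<dots> \<le> (\<Sum>t\<in>{3..T}. 2 * real_of_int (aff_dim B - aff_dim Q) * real (card (P t)))"
      proof (rule sum_mono)
        fix t assume t: "t \<in> {3..T}"
        have "aff_dim (P t) < aff_dim B" using aff_dim_subset[OF PQ[OF t]] lt by simp
        then have "bonus B (P t) = 0" by (simp add: bonus_def)
        then show "level_weight B (P t) - level_weight Q (P t)
            \<le> 2 * real_of_int (aff_dim B - aff_dim Q) * real (card (P t))"
          using bonus_bounds(1)[of Q "P t"] by (simp add: level_weight_def algebra_simps)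
      qed
      also have "\<dots> = 2 * real_of_int (aff_dim B - aff_dim Q) * (\<Sum>q\<in>Q. real (w q - 2))"
      proof -
        have "P t = superlevel w Q t" if "t \<in> {3..T}" for t
          using that by (auto simp: P_def Q_def superlevel_def)
        then have "(\<Sum>t\<in>{3..T}. card (P t)) = (\<Sum>t\<in>{Suc 2..T}. card (superlevel w Q t))"
          by (intro sum.cong) auto
        also have "\<dots> = (\<Sum>q\<in>Q. w q - 2)"
          by (rule sum_card_superlevel) (use fQ wQ assms(3) QB in auto)
        finally have "(\<Sum>t\<in>{3..T}. real (card (P t))) = (\<Sum>q\<in>Q. real (w q - 2))"
          by (metis of_nat_sum)
        then show ?thesis by (simp flip: sum_distrib_left)
      qed
      also have "\<dots> \<le> (\<Sum>x\<in>bidiff B Q - sdiff Q Q. real (G x - 2))"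
      proof (rule sum_bidiff_ge)
        fix b q assume bq: "b \<in> B" "q \<in> Q"
        show "real (w q - 2) \<le> real (G (b - q) - 2)"
          using GQ[of b q] assms(2)[of b] bq QB by auto
        show "real (w q - 2) \<le> real (G (q - b) - 2)"
          using GQ[of q b] assms(2)[of b] bq QB by auto
      qed (use assms QB in auto)
      finally show ?thesis .
    qed
    moreover have "Q = B \<Longrightarrow> ?thesis" by (simp add: sum_nonneg)
    ultimately show ?thesis by blast
  qed
  have "(\<Sum>x\<in>sdiff B B. real (G x)) = (\<Sum>x\<in>sdiff B B - bidiff B Q. real (G x)) + (\<Sum>x\<in>bidiff B Q. real (G x))"
    by (rule sum.subset_diff) (use SB assms in auto)
  also have "(\<Sum>x\<in>bidiff B Q. real (G x)) = (\<Sum>x\<in>bidiff B Q - sdiff Q Q. real (G x)) + (\<Sum>x\<in>sdiff Q Q. real (G x))"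
    by (rule sum.subset_diff) (use QQ assms fQ in auto)
  also have "(\<Sum>x\<in>bidiff B Q - sdiff Q Q. real (G x)) = (\<Sum>x\<in>bidiff B Q - sdiff Q Q. real (G x - 2) + 2)"
    by (intro sum.cong refl) (use G2 in \<open>force simp: of_nat_diff\<close>)
  also have "\<dots> = (\<Sum>x\<in>bidiff B Q - sdiff Q Q. real (G x - 2)) + 2 * real (card (bidiff B Q - sdiff Q Q))"
    by (simp add: sum.distrib)
  finally have main: "(\<Sum>x\<in>sdiff B B. real (G x)) = (\<Sum>x\<in>sdiff B B - bidiff B Q. real (G x))
      + ((\<Sum>x\<in>bidiff B Q - sdiff Q Q. real (G x - 2)) + 2 * real (card (bidiff B Q - sdiff Q Q)) + (\<Sum>x\<in>sdiff Q Q. real (G x)))" .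
  have "(\<Sum>x\<in>sdiff B B - bidiff B Q. 1) \<le> (\<Sum>x\<in>sdiff B B - bidiff B Q. real (G x))"
    by (rule sum_mono) (use G1 in force)
  then have "real (card (sdiff B B - bidiff B Q)) \<le> (\<Sum>x\<in>sdiff B B - bidiff B Q. real (G x))"
    by simp
  moreover have "real (card (sdiff B B - bidiff B Q)) = real (card (sdiff B B)) - real (card (bidiff B Q))"
    using SB fQ assms by (simp add: card_Diff_subset card_mono of_nat_diff)
  moreover have "real (card (bidiff B Q - sdiff Q Q)) = real (card (bidiff B Q)) - real (card (sdiff Q Q))"
    using QQ fQ assms by (simp add: card_Diff_subset card_mono of_nat_diff)
  ultimately show ?thesis
    using main IH' EX unfolding Q_def[symmetric] unfolding P_def[symmetric] by linarith
qed

lemma sum_fibres_ge: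
  fixes B :: "'a::euclidean_space set" and w G :: "'a \<Rightarrow> nat"
  assumes "finite B" "\<And>b. b \<in> B \<Longrightarrow> 1 \<le> w b" "\<And>b. b \<in> B \<Longrightarrow> w b \<le> T"
    and "\<And>b b'. b \<in> B \<Longrightarrow> b' \<in> B \<Longrightarrow> w b + w b' \<le> G (b - b') + 1"
  shows "real (card (sdiff B B)) + (\<Sum>t\<in>{2..T}. level_weight B (superlevel w B t))
      \<le> (\<Sum>x\<in>sdiff B B. real (G x))"
    and "real (card (sdiff B B)) + real (card (bidiff B (superlevel w B 2)))
      + real (card (sdiff (superlevel w B 2) (superlevel w B 2)))
      + (\<Sum>t\<in>{3..T}. level_weight B (superlevel w B t)) \<le> (\<Sum>x\<in>sdiff B B. real (G x))"
proof -
  have *: "real (card (sdiff B B)) + (\<Sum>t\<in>{2..T}. level_weight B (superlevel w B t))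
      \<le> (\<Sum>x\<in>sdiff B B. real (G x)) \<and>
      real (card (sdiff B B)) + real (card (bidiff B (superlevel w B 2)))
      + real (card (sdiff (superlevel w B 2) (superlevel w B 2)))
      + (\<Sum>t\<in>{3..T}. level_weight B (superlevel w B t)) \<le> (\<Sum>x\<in>sdiff B B. real (G x))"
    using assms
  proof (induction T arbitrary: B w G)
    case 0
    then have "B = {}" by fastforce
    then show ?case by (simp add: bidiff_def superlevel_def)
  next
    case (Suc T)
    let ?Q = "superlevel w B 2"
    have two: "real (card (sdiff B B)) + real (card (bidiff B ?Q)) + real (card (sdiff ?Q ?Q))
      + (\<Sum>t\<in>{3..Suc T}. level_weight B (superlevel w B t)) \<le> (\<Sum>x\<in>sdiff B B. real (G x))"
    proof (rule sum_fibres_ge_two_levels)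
      fix Q w' G'
      assume Q: "Q = superlevel w B 2" "w' = (\<lambda>b. w b - 1)" "G' = (\<lambda>x. G x - 2)"
      have mem: "b \<in> B \<and> 2 \<le> w b" if "b \<in> Q" for b using that Q by (auto simp: superlevel_def)
      have "real (card (sdiff Q Q)) + (\<Sum>t\<in>{2..T}. level_weight Q (superlevel w' Q t))
         \<le> (\<Sum>x\<in>sdiff Q Q. real (G' x))"
      proof (rule Suc.IH[THEN conjunct1])
        fix b b' assume "b \<in> Q" "b' \<in> Q"
        then show "w' b + w' b' \<le> G' (b - b') + 1"
          using mem[of b] mem[of b'] Suc.prems(4)[of b b'] unfolding Q by auto
      qed (use Suc.prems mem Q in force)+
      then show "real (card (sdiff Q Q)) + (\<Sum>t\<in>{2..Suc T - 1}. level_weight Q (superlevel w' Q t))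
         \<le> (\<Sum>x\<in>sdiff Q Q. real (G' x))" by simp
    qed (use Suc.prems in auto)
    have lw: "level_weight B ?Q \<le> real (card (bidiff B ?Q)) + real (card (sdiff ?Q ?Q))"
      by (rule card_bidiff_ge) (use Suc.prems superlevel_subset[of w B 2] in simp_all)
    show ?case
    proof (cases "T = 0")
      case True
      have "real (card (sdiff B B)) \<le> (\<Sum>x\<in>sdiff B B. real (G x))"
        using two True by auto
      then show ?thesis using two True by simp
    next
      case False
      then have "{2..Suc T} = insert 2 {3..Suc T}" by auto
      then have "(\<Sum>t\<in>{2..Suc T}. level_weight B (superlevel w B t))
        = level_weight B ?Q + (\<Sum>t\<in>{3..Suc T}. level_weight B (superlevel w B t))" by simp
      then show ?thesis using two lw by linarith
    qed
  qed
  then show "real (card (sdiff B B)) + (\<Sum>t\<in>{2..T}. level_weight B (superlevel w B t))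
      \<le> (\<Sum>x\<in>sdiff B B. real (G x))" by blast
  from * show "real (card (sdiff B B)) + real (card (bidiff B (superlevel w B 2)))
      + real (card (sdiff (superlevel w B 2) (superlevel w B 2)))
      + (\<Sum>t\<in>{3..T}. level_weight B (superlevel w B t)) \<le> (\<Sum>x\<in>sdiff B B. real (G x))" by blast
qed

section \<open>Projection along a line\<close>

definition line_proj :: "'a::euclidean_space \<Rightarrow> 'a \<Rightarrow> 'a"
  where "line_proj u x = x - ((x \<bullet> u) / (u \<bullet> u)) *\<^sub>R u"

lemma linear_line_proj: "linear (line_proj u)"
  by (rule linearI) (simp_all add: line_proj_def inner_add_left algebra_simps add_divide_distrib scaleR_add_left)

lemma line_proj_diff: "line_proj u (x - y) = line_proj u x - line_proj u y"
  by (rule linear_diff[OF linear_line_proj])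

lemma line_proj_scaleR: "line_proj u (c *\<^sub>R u) = 0"
  by (cases "u = 0") (simp_all add: line_proj_def)

lemma line_proj_orthogonal: "line_proj u x \<bullet> u = 0"
  by (cases "u = 0") (simp_all add: line_proj_def inner_diff_left)

lemma line_proj_eqD:
  assumes "line_proj u x = line_proj u y"
  obtains c where "x - y = c *\<^sub>R u"
proof -
  have "x - y = ((x \<bullet> u) / (u \<bullet> u) - (y \<bullet> u) / (u \<bullet> u)) *\<^sub>R u"
    using assms by (simp add: line_proj_def algebra_simps)
  then show ?thesis using that by blast
qed

lemma line_proj_inj:
  assumes "line_proj u x = line_proj u y" "x \<bullet> u = y \<bullet> u"
  shows "x = y"
  using assms by (simp add: line_proj_def)

lemma aff_dim_translate_dim:
  fixes A :: "'a::euclidean_space set"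
  assumes "a \<in> A"
  shows "aff_dim A = int (dim ((\<lambda>x. x - a) ` A))"
  using aff_dim_eq_dim[of a A] assms by (simp add: hull_inc)

lemma aff_dim_line_proj:
  fixes A :: "'a::euclidean_space set"
  assumes "a \<in> A" "a' \<in> A" "a \<noteq> a'" "line_proj u a = line_proj u a'"
  shows "aff_dim (line_proj u ` A) = aff_dim A - 1"
proof -
  let ?f = "line_proj u"
  define S where "S = (\<lambda>x. x - a) ` A"
  obtain c where c: "a' - a = c *\<^sub>R u" using assms(4) line_proj_eqD by metis
  then have "c \<noteq> 0" using assms by auto
  have "a' - a \<in> span S" unfolding S_def using assms by (intro span_base) auto
  then have "c *\<^sub>R u \<in> span S" using c by simp
  then have "(1/c) *\<^sub>R (c *\<^sub>R u) \<in> span S" by (rule span_scale)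
  then have u: "u \<in> span S" using \<open>c \<noteq> 0\<close> by simp
  have u0: "u \<noteq> 0" using c assms by auto
  have "(\<lambda>x. x - ?f a) ` (?f ` A) = ?f ` S"
    by (auto simp: S_def line_proj_diff image_image)
  then have 1: "aff_dim (?f ` A) = int (dim (?f ` S))"
    using aff_dim_translate_dim[of "?f a" "?f ` A"] assms by simp
  have 2: "aff_dim A = int (dim S)" unfolding S_def by (rule aff_dim_translate_dim) fact
  have "u \<notin> span (?f ` S)"
  proof
    assume "u \<in> span (?f ` S)"
    moreover have "span (?f ` S) \<subseteq> {x. x \<bullet> u = 0}"
      by (rule span_minimal) (auto simp: subspace_def inner_add_left line_proj_orthogonal)
    ultimately have "u \<bullet> u = 0" by blast
    then show False using u0 by simp
  qed
  then have "dim (insert u (?f ` S)) = dim (?f ` S) + 1" by (simp add: dim_insert)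
  moreover have "span (insert u (?f ` S)) = span S"
  proof (rule span_eq[THEN iffD2], intro conjI subsetI)
    fix y assume "y \<in> insert u (?f ` S)"
    then show "y \<in> span S"
      using u by (auto simp: line_proj_def intro!: span_diff span_scale intro: span_base)
  next
    fix y assume y: "y \<in> S"
    have "y = ?f y + ((y \<bullet> u) / (u \<bullet> u)) *\<^sub>R u" by (simp add: line_proj_def)
    moreover have "?f y + ((y \<bullet> u) / (u \<bullet> u)) *\<^sub>R u \<in> span (insert u (?f ` S))"
      by (intro span_add span_scale span_base) (use y in auto)
    ultimately show "y \<in> span (insert u (?f ` S))" by simp
  qed
  then have "dim (insert u (?f ` S)) = dim S" by (metis dim_span)
  ultimately show ?thesis using 1 2 by simp
qed

lemma card_sdiff_real:
  fixes X Y :: "real set"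
  assumes "finite X" "finite Y" "X \<noteq> {}" "Y \<noteq> {}"
  shows "card X + card Y \<le> card (sdiff X Y) + 1"
proof -
  let ?X = "(\<lambda>x. x - Max Y) ` X" and ?Y = "(\<lambda>y. Max X - y) ` Y"
  have "?X \<inter> ?Y \<subseteq> {Max X - Max Y}"
  proof
    fix z assume "z \<in> ?X \<inter> ?Y"
    then obtain x y where "x \<in> X" "y \<in> Y" "z = x - Max Y" "z = Max X - y" by auto
    moreover have "x \<le> Max X" "y \<le> Max Y" using calculation assms by auto
    ultimately show "z \<in> {Max X - Max Y}" by simp
  qed
  then have "card (?X \<inter> ?Y) \<le> 1" using card_mono[of "{Max X - Max Y}"] by fastforce
  moreover have "card ?X = card X" "card ?Y = card Y" by (auto intro!: card_image simp: inj_on_def)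
  moreover have "card ?X + card ?Y = card (?X \<union> ?Y) + card (?X \<inter> ?Y)"
    by (rule card_Un_Int) (use assms in auto)
  moreover have "card (?X \<union> ?Y) \<le> card (sdiff X Y)"
    by (rule card_mono) (use Max_in[OF assms(1,3)] Max_in[OF assms(2,4)] assms in \<open>auto intro!: sdiffI simp del: Max_in\<close>)
  ultimately show ?thesis by linarith
qed

lemma card_sdiff_line:
  fixes X Y :: "'a::euclidean_space set"
  assumes "finite X" "finite Y" "X \<noteq> {}" "Y \<noteq> {}" "inj_on (\<lambda>x. x \<bullet> u) X" "inj_on (\<lambda>x. x \<bullet> u) Y"
  shows "card X + card Y \<le> card (sdiff X Y) + 1"
proof -
  let ?g = "\<lambda>x. x \<bullet> u"
  have "card X + card Y = card (?g ` X) + card (?g ` Y)" using assms by (simp add: card_image)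
  also have "\<dots> \<le> card (sdiff (?g ` X) (?g ` Y)) + 1" by (rule card_sdiff_real) (use assms in auto)
  also have "sdiff (?g ` X) (?g ` Y) = ?g ` sdiff X Y"
    by (force simp: sdiff_def inner_diff_left image_iff)
  also have "card (?g ` sdiff X Y) \<le> card (sdiff X Y)" using assms by (intro card_image_le) auto
  finally show ?thesis by simp
qed

definition fibre_card :: "'a::euclidean_space \<Rightarrow> 'a set \<Rightarrow> 'a \<Rightarrow> nat"
  where "fibre_card u A b = card {a\<in>A. line_proj u a = b}"

definition level :: "'a::euclidean_space \<Rightarrow> 'a set \<Rightarrow> nat \<Rightarrow> 'a set"
  where "level u A t = superlevel (fibre_card u A) (line_proj u ` A) t"

lemma finite_level [simp, intro]: "finite A \<Longrightarrow> finite (level u A t)"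
  by (simp add: level_def)

lemma level_subset: "level u A t \<subseteq> line_proj u ` A"
  unfolding level_def by (rule superlevel_subset)

lemma level_antimono: "s \<le> t \<Longrightarrow> level u A t \<subseteq> level u A s"
  by (auto simp: level_def superlevel_def)

lemma fibre_card_pos: "finite A \<Longrightarrow> b \<in> line_proj u ` A \<Longrightarrow> 1 \<le> fibre_card u A b"
  by (auto simp: fibre_card_def Suc_le_eq card_gt_0_iff)

lemma sum_fibre_card: "finite A \<Longrightarrow> (\<Sum>b\<in>line_proj u ` A. fibre_card u A b) = card A"
  using sum.group[of A "line_proj u ` A" "line_proj u" "\<lambda>_. 1::nat"] by (simp add: fibre_card_def)

lemma sum_card_level:
  assumes "finite A"
  shows "(\<Sum>t\<in>{2..card A}. card (level u A t)) + card (line_proj u ` A) = card A"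
proof -
  have "(\<Sum>t\<in>{Suc 1..card A}. card (superlevel (fibre_card u A) (line_proj u ` A) t))
      = (\<Sum>b\<in>line_proj u ` A. fibre_card u A b - 1)"
    by (rule sum_card_superlevel)
      (use assms fibre_card_pos in \<open>auto simp: fibre_card_def intro: card_mono\<close>)
  moreover have "(\<Sum>b\<in>line_proj u ` A. fibre_card u A b - 1) + card (line_proj u ` A)
      = (\<Sum>b\<in>line_proj u ` A. (fibre_card u A b - 1) + 1)" by (simp only: sum.distrib) simp
  moreover have "\<dots> = card A"
    using fibre_card_pos[OF assms] sum_fibre_card[OF assms, of u]
    by (metis (no_types, lifting) le_add_diff_inverse2 sum.cong)
  ultimately show ?thesis by (simp add: level_def numeral_2_eq_2)
qed

lemma card_sdiff_ge_levels:
  fixes A :: "'a::euclidean_space set" and u :: 'a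
  assumes "finite A"
  defines "B \<equiv> line_proj u ` A" and "P \<equiv> level u A"
  shows "real (card (sdiff B B)) + (\<Sum>t\<in>{2..card A}. level_weight B (P t)) \<le> real (card (sdiff A A))"
    and "real (card (sdiff B B)) + real (card (bidiff B (P 2))) + real (card (sdiff (P 2) (P 2)))
      + (\<Sum>t\<in>{3..card A}. level_weight B (P t)) \<le> real (card (sdiff A A))"
proof -
  define G where "G = (\<lambda>x. card {y\<in>sdiff A A. line_proj u y = x})"
  let ?w = "fibre_card u A"
  have finB: "finite B" using assms by (simp add: B_def)
  have "line_proj u ` sdiff A A = sdiff B B"
    unfolding B_def by (force simp: sdiff_def line_proj_diff image_iff)
  then have "(\<Sum>x\<in>sdiff B B. real (G x)) = real (card (sdiff A A))"
    using sum.group[of "sdiff A A" "sdiff B B" "line_proj u" "\<lambda>_. 1::real"] assms(1) finB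
    by (simp add: G_def)
  moreover have G: "?w b + ?w b' \<le> G (b - b') + 1" if "b \<in> B" "b' \<in> B" for b b'
  proof -
    let ?X = "{a\<in>A. line_proj u a = b}" and ?Y = "{a\<in>A. line_proj u a = b'}"
    have inj: "inj_on (\<lambda>x. x \<bullet> u) {a\<in>A. line_proj u a = c}" for c
      by (rule inj_onI, rule line_proj_inj[of u]) auto
    have "card ?X + card ?Y \<le> card (sdiff ?X ?Y) + 1"
      by (rule card_sdiff_line[OF _ _ _ _ inj inj]) (use assms(1) that in \<open>auto simp: B_def\<close>)
    also have "card (sdiff ?X ?Y) \<le> G (b - b')"
      unfolding G_def by (rule card_mono) (use assms(1) in \<open>auto simp: line_proj_diff\<close>)
    finally show ?thesis by (simp add: fibre_card_def)
  qed
  moreover have w1: "1 \<le> ?w b" if "b \<in> B" for b using that assms(1) fibre_card_pos by (auto simp: B_def)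
  moreover have w2: "?w b \<le> card A" if "b \<in> B" for b
    using assms(1) by (auto simp: fibre_card_def intro: card_mono)
  ultimately show "real (card (sdiff B B)) + (\<Sum>t\<in>{2..card A}. level_weight B (P t)) \<le> real (card (sdiff A A))"
    and "real (card (sdiff B B)) + real (card (bidiff B (P 2))) + real (card (sdiff (P 2) (P 2)))
      + (\<Sum>t\<in>{3..card A}. level_weight B (P t)) \<le> real (card (sdiff A A))"
    using sum_fibres_ge[of B ?w "card A" G, OF finB w1 w2 G]
    by (simp_all add: P_def level_def B_def[symmetric] bidiff_def)
qed

lemma card_translates_le:
  fixes A :: "'a::euclidean_space set"
  assumes "finite A" "u \<noteq> 0"
  shows "card {a\<in>A. a + u \<in> A} + card (line_proj u ` A) \<le> card A"
proof -
  let ?R = "{a\<in>A. a + u \<in> A}"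
  have "line_proj u ` A \<subseteq> line_proj u ` (A - ?R)"
  proof
    fix b assume "b \<in> line_proj u ` A"
    let ?F = "{a\<in>A. line_proj u a = b}"
    have F: "finite ?F" "?F \<noteq> {}" using \<open>b \<in> _\<close> assms by auto
    obtain a where a: "is_arg_min (\<lambda>a. - (a \<bullet> u)) (\<lambda>a. a \<in> ?F) a"
      using ex_is_arg_min_if_finite[OF F] by blast
    have "a + u \<notin> A"
    proof
      assume "a + u \<in> A"
      moreover have "line_proj u (a + u) = line_proj u a"
        using line_proj_scaleR[of u 1] linear_add[OF linear_line_proj, of u a u] by simp
      ultimately have "a + u \<in> ?F" using a by (auto simp: is_arg_min_def)
      moreover have "a \<bullet> u < (a + u) \<bullet> u" using assms by (simp add: inner_add_left)
      ultimately show False using a by (auto simp: is_arg_min_def)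
    qed
    then show "b \<in> line_proj u ` (A - ?R)" using a by (auto simp: is_arg_min_def)
  qed
  then have "card (line_proj u ` A) \<le> card (A - ?R)"
    using assms by (meson card_image_le card_mono finite_Diff finite_imageI le_trans)
  moreover have "card (A - ?R) = card A - card ?R" by (rule card_Diff_subset) (use assms in auto)
  moreover have "card ?R \<le> card A" by (rule card_mono) (use assms in auto)
  ultimately show ?thesis by linarith
qed

text \<open>A point of maximal norm is exposed, so removing it from \<open>Q\<close> loses at least one difference in
  each coset of the span of \<open>Q - Q\<close> that meets \<open>A\<close>.\<close>

lemma remove_extreme_point:
  fixes A Q :: "'a::euclidean_space set"
  assumes "finite A" "finite Q" "Q \<noteq> {}"
  obtains b M where "b \<in> Q" "M \<subseteq> A" "card (sdiff A Q) = card (sdiff A (Q - {b})) + card M"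
    "\<And>a. a \<in> A \<Longrightarrow> \<exists>\<mu>\<in>M. a - \<mu> \<in> span ((\<lambda>q. q - b) ` Q)"
proof -
  obtain b where b: "is_arg_min (\<lambda>q. - norm q) (\<lambda>q. q \<in> Q) b"
    using ex_is_arg_min_if_finite[OF assms(2,3)] by blast
  then have bQ: "b \<in> Q" by (simp add: is_arg_min_def)
  have lt: "q \<bullet> b < b \<bullet> b" if "q \<in> Q - {b}" for q
  proof -
    have nq: "norm q \<le> norm b" using b that by (auto simp: is_arg_min_def not_less)
    have "0 < (q - b) \<bullet> (q - b)" using that by simp
    then have "2 * (q \<bullet> b) < q \<bullet> q + b \<bullet> b" by (simp add: inner_diff_left inner_diff_right inner_commute)
    moreover have "q \<bullet> q \<le> b \<bullet> b" using nq by (simp add: dot_square_norm power_mono)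
    ultimately show ?thesis by simp
  qed
  define W where "W = span ((\<lambda>q. q - b) ` Q)"
  define M where "M = {a\<in>A. a - b \<notin> sdiff A (Q - {b})}"
  have split: "sdiff A Q = sdiff A (Q - {b}) \<union> (\<lambda>a. a - b) ` M"
  proof -
    have "sdiff A Q = sdiff A (Q - {b}) \<union> (\<lambda>a. a - b) ` A" unfolding sdiff_def using bQ by blast
    also have "\<dots> = sdiff A (Q - {b}) \<union> (\<lambda>a. a - b) ` M" unfolding M_def by blast
    finally show ?thesis .
  qed
  have "card (sdiff A Q) = card (sdiff A (Q - {b})) + card ((\<lambda>a. a - b) ` M)"
    unfolding split by (rule card_Un_disjoint) (use assms in \<open>auto simp: M_def\<close>)
  also have "card ((\<lambda>a. a - b) ` M) = card M" by (rule card_image) (auto simp: inj_on_def)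
  finally have c: "card (sdiff A Q) = card (sdiff A (Q - {b})) + card M" .
  have "\<exists>\<mu>\<in>M. a - \<mu> \<in> W" if a: "a \<in> A" for a
  proof -
    let ?X = "{x\<in>A. a - x \<in> W}"
    have "a \<in> ?X" using a by (simp add: W_def span_zero)
    then have X: "finite ?X" "?X \<noteq> {}" using assms by auto
    obtain x where x: "is_arg_min (\<lambda>x. x \<bullet> b) (\<lambda>x. x \<in> ?X) x" using ex_is_arg_min_if_finite[OF X] by blast
    have xX: "x \<in> ?X" using x by (simp add: is_arg_min_def)
    have "x - b \<notin> sdiff A (Q - {b})"
    proof
      assume "x - b \<in> sdiff A (Q - {b})"
      then obtain y q where y: "y \<in> A" "q \<in> Q - {b}" "x - b = y - q" by blast
      then have yx: "y = x + (q - b)" by (simp add: algebra_simps)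
      have "q - b \<in> W" unfolding W_def using y by (intro span_base) auto
      then have "a - y \<in> W" using xX unfolding yx W_def by (auto simp: diff_diff_eq[symmetric] intro: span_diff)
      then have "y \<in> ?X" using y by simp
      moreover have "y \<bullet> b < x \<bullet> b" using lt[OF y(2)] by (simp add: yx inner_add_left inner_diff_left)
      ultimately show False using x by (auto simp: is_arg_min_def)
    qed
    then show ?thesis using xX by (auto simp: M_def)
  qed
  then show ?thesis using that[OF bQ _ c] unfolding W_def M_def by blast
qed

lemma card_cosets_ge:
  fixes A M Q :: "'a::euclidean_space set"
  assumes "finite A" "A \<noteq> {}" "M \<subseteq> A" "b \<in> Q"
    and "\<And>a. a \<in> A \<Longrightarrow> \<exists>\<mu>\<in>M. a - \<mu> \<in> span ((\<lambda>q. q - b) ` Q)"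
  shows "aff_dim A - aff_dim Q + 1 \<le> int (card M)"
proof -
  define S where "S = (\<lambda>q. q - b) ` Q"
  have finM: "finite M" using assms finite_subset by blast
  obtain a where "a \<in> A" using assms by blast
  then obtain m where m: "m \<in> M" using assms(5) by blast
  obtain T where T: "T \<subseteq> span S" "independent T" "span S \<subseteq> span T" "card T = dim (span S)"
    using basis_exists by blast
  have finT: "finite T" using T(2) by (rule independent_imp_finite)
  let ?N = "(\<lambda>x. x - m) ` (M - {m}) \<union> T"
  have "(\<lambda>x. x - m) ` A \<subseteq> span ?N"
  proof (rule image_subsetI)
    fix a assume "a \<in> A"
    then obtain \<mu> where \<mu>: "\<mu> \<in> M" "a - \<mu> \<in> span S" using assms(5) unfolding S_def by blast
    then have "a - \<mu> \<in> span ?N" using T(3) span_mono[of T ?N] by blast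
    moreover have "\<mu> - m \<in> span ?N"
    proof (cases "\<mu> = m")
      case True
      then show ?thesis by (simp add: span_zero)
    next
      case False
      then show ?thesis using \<mu> by (intro span_base) auto
    qed
    ultimately have "(a - \<mu>) + (\<mu> - m) \<in> span ?N" by (rule span_add)
    then show "a - m \<in> span ?N" by simp
  qed
  then have "dim ((\<lambda>x. x - m) ` A) \<le> card ?N"
    using finM finT by (intro dim_le_card) auto
  also have "\<dots> \<le> card ((\<lambda>x. x - m) ` (M - {m})) + card T" by (rule card_Un_le)
  also have "card ((\<lambda>x. x - m) ` (M - {m})) \<le> card (M - {m})" using finM by (intro card_image_le) auto
  also have "card (M - {m}) = card M - 1" using m by simp
  finally have "dim ((\<lambda>x. x - m) ` A) \<le> card M - 1 + dim S" using T by simp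
  moreover have "aff_dim A = int (dim ((\<lambda>x. x - m) ` A))" using m assms by (intro aff_dim_translate_dim) auto
  moreover have "aff_dim Q = int (dim S)" unfolding S_def using assms by (intro aff_dim_translate_dim) auto
  moreover have "card M \<noteq> 0" using m finM by auto
  ultimately show ?thesis by linarith
qed

lemma card_line_proj_ge:
  fixes A :: "'a::euclidean_space set"
  assumes "finite A" "A \<noteq> {}"
  shows "aff_dim A \<le> int (card (line_proj u ` A))"
proof (cases "u = 0")
  case True
  then have "line_proj u ` A = A" by (simp add: line_proj_def)
  then show ?thesis using aff_dim_le_card[OF assms(1)] by simp
next
  case False
  obtain M where M: "M \<subseteq> A" "inj_on (line_proj u) M" "line_proj u ` A = line_proj u ` M"
    using subset_image_inj[of "line_proj u ` A" "line_proj u" A] by auto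
  have "aff_dim A - aff_dim {0, u} + 1 \<le> int (card M)"
  proof (rule card_cosets_ge[OF assms M(1), of 0])
    fix a assume "a \<in> A"
    then obtain \<mu> where \<mu>: "\<mu> \<in> M" "line_proj u a = line_proj u \<mu>" using M(3) by (metis imageE imageI)
    then obtain c where "a - \<mu> = c *\<^sub>R u" using line_proj_eqD by metis
    moreover have "c *\<^sub>R u \<in> span ((\<lambda>q. q - 0) ` {0, u})" by (intro span_scale span_base) auto
    ultimately show "\<exists>\<mu>\<in>M. a - \<mu> \<in> span ((\<lambda>q. q - 0) ` {0, u})" using \<mu>(1) by metis
  qed simp
  moreover have "card M = card (line_proj u ` A)" using M by (simp add: card_image)
  moreover have "aff_dim {0, u} = 1" using False by (simp add: aff_dim_2)
  ultimately show ?thesis by simp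
qed

lemma card_sdiff_sing: "card (sdiff A {b}) = card A" for b :: "'a::euclidean_space"
proof -
  have "sdiff A {b} = (\<lambda>a. a - b) ` A" by (auto simp: sdiff_def)
  then show ?thesis by (simp add: card_image)
qed

lemma card_sdiff_chain:
  fixes A Q :: "'a::euclidean_space set"
  assumes "finite A" "A \<noteq> {}" "finite Q" "2 \<le> card Q"
  defines "k \<equiv> real_of_int (aff_dim A)"
  shows "\<exists>s1 s2. s1 \<in> Q \<and> s2 \<in> Q \<and> s1 \<noteq> s2 \<and>
    real (card A) + (real (card Q) - 1) * (k - real_of_int (aff_dim Q) + 1)
      + real_of_int (aff_dim Q) * (real_of_int (aff_dim Q) - 1) / 2 - k
      + real (card (line_proj (s1 - s2) ` A)) \<le> real (card (sdiff A Q))"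
  using assms(3,4)
proof (induction "card Q" arbitrary: Q)
  case 0
  then show ?case by simp
next
  case (Suc n)
  have "Q \<noteq> {}" using Suc by auto
  then obtain b M where bM: "b \<in> Q" "M \<subseteq> A" "card (sdiff A Q) = card (sdiff A (Q - {b})) + card M"
    and coset: "\<And>a. a \<in> A \<Longrightarrow> \<exists>\<mu>\<in>M. a - \<mu> \<in> span ((\<lambda>q. q - b) ` Q)"
    using remove_extreme_point[OF assms(1) Suc.prems(1)] by metis
  have finM: "finite M" using bM assms(1) finite_subset by blast
  show ?case
  proof (cases "n = 1")
    case True
    then have "card (Q - {b}) = 1" using Suc bM by simp
    then obtain c where c: "Q - {b} = {c}" by (rule card_1_singletonE)
    then have Q: "Q = {b, c}" "c \<noteq> b" using bM by auto
    have sub: "line_proj (c - b) ` A \<subseteq> line_proj (c - b) ` M"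
    proof (rule image_subsetI)
      fix a assume "a \<in> A"
      then obtain \<mu> where \<mu>: "\<mu> \<in> M" "a - \<mu> \<in> span ((\<lambda>q. q - b) ` Q)" using coset by blast
      moreover have "span ((\<lambda>q. q - b) ` Q) = span {c - b}" using Q by (simp add: span_insert_0)
      ultimately obtain t where "a - \<mu> = t *\<^sub>R (c - b)" by (auto simp: span_singleton)
      then have "line_proj (c - b) (a - \<mu>) = 0" by (simp add: line_proj_scaleR)
      then have "line_proj (c - b) a = line_proj (c - b) \<mu>" by (simp add: line_proj_diff)
      then show "line_proj (c - b) a \<in> line_proj (c - b) ` M" using \<mu> by simp
    qed
    have "card (line_proj (c - b) ` A) \<le> card M"
      using card_mono[OF _ sub] card_image_le[OF finM, of "line_proj (c - b)"] finM by fastforce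
    moreover have "aff_dim Q = 1" "card Q = 2" using Q by (auto simp: aff_dim_2)
    moreover have "card (sdiff A (Q - {b})) = card A" using c by (simp add: card_sdiff_sing)
    ultimately show ?thesis using bM(3) Q by (intro exI[of _ c] exI[of _ b]) simp
  next
    case False
    let ?Q = "Q - {b}"
    have cQ: "card ?Q = n" "2 \<le> n" using Suc bM False by auto
    then obtain s1 s2 where s: "s1 \<in> ?Q" "s2 \<in> ?Q" "s1 \<noteq> s2"
      "real (card A) + (real (card ?Q) - 1) * (k - real_of_int (aff_dim ?Q) + 1)
      + real_of_int (aff_dim ?Q) * (real_of_int (aff_dim ?Q) - 1) / 2 - k
      + real (card (line_proj (s1 - s2) ` A)) \<le> real (card (sdiff A ?Q))"
      using Suc.hyps(1)[of ?Q] Suc.prems by auto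
    define j where "j = real_of_int (aff_dim Q)"
    have cM: "k - j + 1 \<le> real (card M)"
      using card_cosets_ge[OF assms(1,2) bM(2,1) coset] unfolding k_def j_def by linarith
    have cQ': "real (card Q) = real (card ?Q) + 1" using cQ Suc by simp
    have insQ: "insert b ?Q = Q" using bM by auto
    have "aff_dim Q \<le> int (card Q) - 1" using aff_dim_le_card[OF Suc.prems(1)] .
    then have jq: "j \<le> real (card ?Q)" unfolding j_def using cQ' by linarith
    have "real (card A) + (real (card Q) - 1) * (k - j + 1) + j * (j - 1) / 2 - k
      + real (card (line_proj (s1 - s2) ` A)) \<le> real (card (sdiff A ?Q)) + real (card M)"
    proof (cases "aff_dim ?Q = aff_dim Q")
      case True
      then have "real_of_int (aff_dim ?Q) = j" by (simp add: j_def)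
      then show ?thesis using s(4) cM unfolding cQ' by (simp add: algebra_simps)
    next
      case False
      then have j': "real_of_int (aff_dim ?Q) = j - 1"
        using aff_dim_insert[of b ?Q] unfolding insQ j_def by (auto split: if_splits)
      have "(real (card Q) - 1) * (k - j + 1) + j * (j - 1) / 2
        = (real (card ?Q) - 1) * (k - (j - 1) + 1) + (j - 1) * (j - 1 - 1) / 2
          + (k - j + 1) - (real (card ?Q) - j)"
        unfolding cQ' by (simp add: field_simps)
      then show ?thesis using s(4) cM jq unfolding j' by linarith
    qed
    then show ?thesis using s bM(3) unfolding j_def by (intro exI[of _ s1] exI[of _ s2]) auto
  qed
qed

lemma card_sdiff_ge:
  fixes A Q :: "'a::euclidean_space set"
  assumes "finite A" "A \<noteq> {}" "finite Q" "Q \<noteq> {}"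
  defines "k \<equiv> real_of_int (aff_dim A)" and "j \<equiv> real_of_int (aff_dim Q)"
  shows "real (card A) + (real (card Q) - 1) * (k - j + 1) + j * (j - 1) / 2 \<le> real (card (sdiff A Q))"
proof (cases "2 \<le> card Q")
  case True
  then obtain s1 s2 where "real (card A) + (real (card Q) - 1) * (k - j + 1) + j * (j - 1) / 2 - k
      + real (card (line_proj (s1 - s2) ` A)) \<le> real (card (sdiff A Q))"
    using card_sdiff_chain[OF assms(1-3)] unfolding k_def j_def by blast
  moreover have "k \<le> real (card (line_proj (s1 - s2) ` A))"
    using card_line_proj_ge[OF assms(1,2), of "s1 - s2"] unfolding k_def by linarith
  ultimately show ?thesis by linarith
next
  case False
  moreover have "card Q \<noteq> 0" using assms by auto
  ultimately have "card Q = 1" by linarith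
  then obtain b where "Q = {b}" by (rule card_1_singletonE)
  then show ?thesis by (simp add: card_sdiff_sing j_def)
qed

lemma sum_translates:
  fixes B :: "'a::euclidean_space set"
  assumes "finite B"
  shows "(\<Sum>x\<in>sdiff B B - {0}. card {b\<in>B. b + x \<in> B}) = card B * (card B - 1)"
proof -
  let ?S = "B \<times> B - Id"
  have "(\<lambda>(a, b). a - b) ` ?S \<subseteq> sdiff B B - {0}" by auto
  then have "(\<Sum>x\<in>sdiff B B - {0}. card {p\<in>?S. (case p of (a, b) \<Rightarrow> a - b) = x}) = card ?S"
    using sum.group[of ?S "sdiff B B - {0}" "\<lambda>(a, b). a - b" "\<lambda>_. 1::nat"] assms by simp
  moreover have "card {p\<in>?S. (case p of (a, b) \<Rightarrow> a - b) = x} = card {b\<in>B. b + x \<in> B}"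
    if "x \<in> sdiff B B - {0}" for x
  proof -
    have "{p\<in>?S. (case p of (a, b) \<Rightarrow> a - b) = x} = (\<lambda>b. (b + x, b)) ` {b\<in>B. b + x \<in> B}"
      using that by (auto simp: image_iff algebra_simps)
    then show ?thesis by (simp add: card_image inj_on_def)
  qed
  ultimately have "(\<Sum>x\<in>sdiff B B - {0}. card {b\<in>B. b + x \<in> B}) = card ?S" by simp
  also have "?S = B \<times> B - (\<lambda>b. (b, b)) ` B" by auto
  also have "card \<dots> = card B * card B - card B"
    using assms by (subst card_Diff_subset) (auto simp: card_image inj_on_def card_cartesian_product)
  finally show ?thesis by (simp add: diff_mult_distrib2)
qed

text \<open>By the parallelogram law a difference of maximal norm is represented only once.\<close>

lemma unique_difference:
  fixes B :: "'a::euclidean_space set"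
  assumes "finite B" "2 \<le> card B"
  obtains x where "x \<in> sdiff B B - {0}" "card {b\<in>B. b + x \<in> B} = 1"
proof -
  have "\<exists>a b. a \<in> B \<and> b \<in> B \<and> a \<noteq> b"
    using assms by (metis card_le_Suc0_iff_eq not_less_eq_eq numeral_2_eq_2)
  then obtain a0 b0 where ab0: "a0 \<in> B" "b0 \<in> B" "a0 \<noteq> b0" by blast
  then have S: "finite (sdiff B B)" "sdiff B B \<noteq> {}" using assms by auto
  obtain x where x: "is_arg_min (\<lambda>x. - norm x) (\<lambda>x. x \<in> sdiff B B) x"
    using ex_is_arg_min_if_finite[OF S] by blast
  then have xS: "x \<in> sdiff B B" by (simp add: is_arg_min_def)
  have mx: "norm y \<le> norm x" if "y \<in> sdiff B B" for y
    using x that by (force simp: is_arg_min_def)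
  have "norm (a0 - b0) \<le> norm x" using ab0 by (intro mx) auto
  then have x0: "x \<noteq> 0" using ab0 by auto
  have uniq: "b = b'" if "b \<in> B" "b + x \<in> B" "b' \<in> B" "b' + x \<in> B" for b b'
  proof -
    have "(x + (b - b')) \<bullet> (x + (b - b')) \<le> x \<bullet> x" "(x - (b - b')) \<bullet> (x - (b - b')) \<le> x \<bullet> x"
    proof -
      have "x + (b - b') \<in> sdiff B B" "x - (b - b') \<in> sdiff B B"
        using sdiffI[OF that(2,3)] sdiffI[OF that(4,1)] by (simp_all add: algebra_simps)
      then show "(x + (b - b')) \<bullet> (x + (b - b')) \<le> x \<bullet> x" "(x - (b - b')) \<bullet> (x - (b - b')) \<le> x \<bullet> x"
        using mx by (simp_all add: dot_square_norm power_mono)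
    qed
    then have "(b - b') \<bullet> (b - b') \<le> 0"
      by (simp add: inner_add_left inner_add_right inner_diff_left inner_diff_right inner_commute)
    then have "(b - b') \<bullet> (b - b') = 0" using inner_ge_zero[of "b - b'"] by linarith
    then show "b = b'" by simp
  qed
  obtain a b where "a \<in> B" "b \<in> B" "x = a - b" using xS by blast
  then have "{b\<in>B. b + x \<in> B} = {b}" using uniq by auto
  then show ?thesis using that[of x] xS x0 by simp
qed

lemma popular_difference:
  fixes B :: "'a::euclidean_space set"
  assumes "finite B" "2 \<le> card B" "1 \<le> R"
    and few: "real R * (real (card (sdiff B B)) - 1) + 1 < real (card B) * (real (card B) - 1) + real R"
  obtains u where "u \<noteq> 0" "R < card {b\<in>B. b + u \<in> B}"
proof -
  have "\<exists>u. u \<noteq> 0 \<and> R < card {b\<in>B. b + u \<in> B}"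
  proof (rule ccontr)
    assume "\<not> ?thesis"
    then have le: "card {b\<in>B. b + u \<in> B} \<le> R" if "u \<noteq> 0" for u using that by (meson not_le)
    obtain x where x: "x \<in> sdiff B B - {0}" "card {b\<in>B. b + x \<in> B} = 1"
      using unique_difference[OF assms(1,2)] by blast
    let ?S = "sdiff B B - {0}"
    have finS: "finite ?S" using assms by simp
    have "card B * (card B - 1) = (\<Sum>y\<in>?S - {x}. card {b\<in>B. b + y \<in> B}) + 1"
      unfolding sum_translates[OF assms(1), symmetric] using x finS
      by (subst sum.remove[of _ x]) auto
    also have "(\<Sum>y\<in>?S - {x}. card {b\<in>B. b + y \<in> B}) \<le> (\<Sum>y\<in>?S - {x}. R)"
      by (rule sum_mono) (use le in auto)
    also have "\<dots> = (card ?S - 1) * R" using x finS by simp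
    also have "card ?S = card (sdiff B B) - 1"
    proof -
      obtain b where "b \<in> B" using assms by fastforce
      then have "b - b \<in> sdiff B B" by (rule sdiffI) fact
      then show ?thesis using assms by (simp add: card_Diff_singleton)
    qed
    finally have "card B * (card B - 1) \<le> (card (sdiff B B) - 1 - 1) * R + 1" by simp
    moreover have "1 \<le> card (sdiff B B) - 1"
      using x finS \<open>card ?S = card (sdiff B B) - 1\<close> by (metis One_nat_def Suc_leI card_gt_0_iff empty_iff)
    moreover have "real (card B * (card B - 1)) = real (card B) * (real (card B) - 1)"
      using assms(2) by (simp add: of_nat_diff)
    moreover have "real ((card (sdiff B B) - 1 - 1) * R + 1) = (real (card (sdiff B B)) - 2) * real R + 1"
      using \<open>1 \<le> card (sdiff B B) - 1\<close> by (simp add: of_nat_diff)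
    ultimately have "real (card B) * (real (card B) - 1) \<le> (real (card (sdiff B B)) - 2) * real R + 1"
      by (metis of_nat_le_iff)
    then show False using few by (simp add: algebra_simps)
  qed
  then show ?thesis using that by blast
qed

section \<open>Difference sets of full dimension\<close>

text \<open>For \<open>k \<ge> 1\<close> the quotient exceeds \<open>m / (2 k)\<close> iff \<open>m > 2 k\<close>. For \<open>k = 0\<close> (where \<open>m = 1\<close>) the
  value is 1.\<close>

definition excess :: "real \<Rightarrow> real \<Rightarrow> real"
  where "excess k m = max 1 ((m - 1) / (2 * k - 1))"

definition diff_bound :: "'a::euclidean_space set \<Rightarrow> bool"
  where "diff_bound B \<longleftrightarrow> real_of_int (aff_dim B) * real (card B)
    + excess (real_of_int (aff_dim B)) (real (card B)) \<le> real (card (sdiff B B))"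

lemma excess_ge_one: "1 \<le> excess k m"
  by (simp add: excess_def)

lemma excess_ge_linear: "(m - 1) / (2 * k - 1) \<le> excess k m"
  by (simp add: excess_def)

lemma excess_one_ge: "m - 1 \<le> excess 1 m"
  by (simp add: excess_def)

lemma excess_ge_linear':
  assumes "1 \<le> j" "j \<le> k" "1 \<le> m"
  shows "(m - 1) / (2 * k - 1) \<le> excess j m"
proof -
  have "(m - 1) / (2 * k - 1) \<le> (m - 1) / (2 * j - 1)"
    using assms by (intro divide_left_mono mult_pos_pos) auto
  then show ?thesis using excess_ge_linear[of m j] by linarith
qed

lemma level_weight_ge:
  assumes "diff_bound P"
  shows "2 * real_of_int (aff_dim B) * real (card P) + 2 * excess (real_of_int (aff_dim P)) (real (card P))
    \<le> level_weight B P"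
  using assms bonus_bounds(1)[of B P] unfolding diff_bound_def level_weight_def by (simp add: algebra_simps)

locale line_fibration =
  fixes B :: "'a::euclidean_space set" and u :: 'a
  assumes finite_B: "finite B"
    and card_proj: "card (line_proj u ` B) < card B"
    and lower_dim: "\<And>S :: 'a set. finite S \<Longrightarrow> S \<noteq> {} \<Longrightarrow> aff_dim S < aff_dim B \<Longrightarrow> diff_bound S"
begin

definition base where "base = line_proj u ` B"
definition multi where "multi = level u B 2"
definition k where "k = real_of_int (aff_dim B)"
definition m where "m = real (card B)"
definition c where "c = real (card base)"
definition q where "q = real (card multi)"
definition j where "j = real_of_int (aff_dim multi)"
definition f where "f = (\<Sum>t\<in>{3..card B}. real (card (level u B t)))"
definition D where "D = real (card (sdiff B B))"

lemma finite_base: "finite base" and finite_multi: "finite multi"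
  using finite_B by (auto simp: base_def multi_def)

lemma base_nonempty: "base \<noteq> {}"
  using card_proj by (auto simp: base_def)

lemma multi_subset: "multi \<subseteq> base"
  unfolding multi_def base_def by (rule level_subset)

lemma aff_dim_base: "aff_dim base = aff_dim B - 1"
proof -
  have "\<not> inj_on (line_proj u) B" using card_proj by (auto dest: card_image)
  then show ?thesis unfolding inj_on_def base_def using aff_dim_line_proj by metis
qed

lemma two_le_card: "2 \<le> card B"
proof -
  have "card (line_proj u ` B) \<noteq> 0" using base_nonempty finite_base by (simp add: base_def)
  then show ?thesis using card_proj by linarith
qed

lemma c_eq: "c = m - q - f"
proof -
  have "(\<Sum>t\<in>{2..card B}. card (level u B t)) + card base = card B"
    unfolding base_def by (rule sum_card_level[OF finite_B])
  then have "(\<Sum>t\<in>{2..card B}. real (card (level u B t))) + c = m"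
    unfolding c_def m_def by (metis of_nat_add of_nat_sum)
  moreover have "{2..card B} = insert 2 {3..card B}" using two_le_card by auto
  ultimately show ?thesis by (simp add: q_def f_def multi_def)
qed

lemma level_3_nonempty:
  assumes "0 < f"
  shows "level u B 3 \<noteq> {}" "3 \<le> card B"
proof -
  obtain t where t: "t \<in> {3..card B}" "level u B t \<noteq> {}"
    using assms unfolding f_def by (metis (lifting) card.empty less_irrefl of_nat_0 sum.neutral)
  then show "level u B 3 \<noteq> {}" using level_antimono[of 3 t u B] by auto
  show "3 \<le> card B" using t by auto
qed

lemma f_nonneg: "0 \<le> f"
  by (simp add: f_def sum_nonneg)

lemma multi_nonempty: "multi \<noteq> {}"
proof
  assume "multi = {}"
  then have "level u B 3 = {}" using level_antimono[of 2 3 u B] by (auto simp: multi_def)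
  then have "f = 0" using level_3_nonempty f_nonneg by fastforce
  moreover have "q = 0" using \<open>multi = {}\<close> by (simp add: q_def)
  moreover have "c < m" using card_proj by (simp add: c_def m_def base_def)
  ultimately show False using c_eq by simp
qed

lemma q_ge_one: "1 \<le> q"
  using multi_nonempty finite_multi by (simp add: q_def Suc_le_eq card_gt_0_iff)

lemma j_bounds: "0 \<le> j" "j \<le> k - 1" "j \<le> q - 1"
proof -
  show "0 \<le> j" using multi_nonempty by (simp add: j_def aff_dim_geq aff_dim_negative_iff not_less[symmetric])
  show "j \<le> k - 1" using aff_dim_subset[OF multi_subset] unfolding j_def k_def aff_dim_base by linarith
  show "j \<le> q - 1" using aff_dim_le_card[OF finite_multi] unfolding j_def q_def by linarith
qed

lemma j_zero: "j = 0 \<Longrightarrow> q = 1"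
  by (auto simp: j_def q_def aff_dim_eq_0)

lemma j_int: "j = 0 \<or> j = 1 \<or> 2 \<le> j"
proof -
  have "aff_dim multi = 0 \<or> aff_dim multi = 1 \<or> 2 \<le> aff_dim multi"
    using j_bounds(1) unfolding j_def by linarith
  then show ?thesis by (auto simp: j_def)
qed

lemma dim_base_real: "real_of_int (aff_dim base) = k - 1"
  by (simp add: aff_dim_base k_def)

lemma lower_dim_base:
  assumes "S \<subseteq> base" "S \<noteq> {}"
  shows "diff_bound S"
proof (rule lower_dim)
  show "finite S" using assms finite_base finite_subset by blast
  show "aff_dim S < aff_dim B" using aff_dim_subset[OF assms(1)] aff_dim_base by simp
qed fact

lemma base_bound: "(k - 1) * c + excess (k - 1) c \<le> real (card (sdiff base base))"
  using lower_dim_base[of base] base_nonempty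
  by (simp add: diff_bound_def aff_dim_base k_def c_def)

lemma multi_bound: "j * q + excess j q \<le> real (card (sdiff multi multi))"
  using lower_dim_base[OF multi_subset multi_nonempty] by (simp add: diff_bound_def j_def q_def)

lemma level_bound:
  "2 * (k - 1) * real (card (level u B t)) \<le> level_weight base (level u B t)"
  "level u B t \<noteq> {} \<Longrightarrow> 2 * (k - 1) * real (card (level u B t))
    + 2 * excess (real_of_int (aff_dim (level u B t))) (real (card (level u B t)))
      \<le> level_weight base (level u B t)"
proof -
  show *: "2 * (k - 1) * real (card (level u B t))
    + 2 * excess (real_of_int (aff_dim (level u B t))) (real (card (level u B t)))
      \<le> level_weight base (level u B t)" if "level u B t \<noteq> {}"
    using level_weight_ge[OF lower_dim_base[OF level_subset[of u B t, folded base_def] that], of base]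
    unfolding dim_base_real .
  show "2 * (k - 1) * real (card (level u B t)) \<le> level_weight base (level u B t)"
  proof (cases "level u B t = {}")
    case True
    then show ?thesis using bonus_bounds(1)[of base "{}"] by (simp add: level_weight_def)
  next
    case False
    then show ?thesis
      using * excess_ge_one[of "real_of_int (aff_dim (level u B t))" "real (card (level u B t))"] by linarith
  qed
qed

lemma all_levels: "real (card (sdiff base base)) + 2 * (k - 1) * (m - c) + 2 * excess j q \<le> D"
proof -
  have "2 * (k - 1) * f \<le> (\<Sum>t\<in>{3..card B}. level_weight base (level u B t))"
    unfolding f_def sum_distrib_left by (rule sum_mono) (rule level_bound)
  moreover have "2 * (k - 1) * q + 2 * excess j q \<le> level_weight base (level u B 2)"
    using level_bound(2)[of 2] multi_nonempty by (simp add: q_def j_def multi_def)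
  moreover have "{2..card B} = insert 2 {3..card B}" using two_le_card by auto
  moreover have "real (card (sdiff base base)) + (\<Sum>t\<in>{2..card B}. level_weight base (level u B t)) \<le> D"
    unfolding D_def base_def by (rule card_sdiff_ge_levels(1)[OF finite_B])
  ultimately show ?thesis by (simp add: c_eq algebra_simps)
qed

lemma two_levels:
  obtains \<sigma> where "0 \<le> \<sigma>" "0 < f \<Longrightarrow> 2 \<le> \<sigma>" "k = 2 \<Longrightarrow> f \<le> \<sigma>"
    "(k - 1) * c + excess (k - 1) c + real (card (bidiff base multi)) + j * q + excess j q
      + 2 * (k - 1) * f + \<sigma> \<le> D"
proof
  let ?\<sigma> = "\<Sum>t\<in>{3..card B}. level_weight base (level u B t) - 2 * (k - 1) * real (card (level u B t))"
  show "0 \<le> ?\<sigma>" by (rule sum_nonneg) (use level_bound(1) in auto)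
  show "2 \<le> ?\<sigma>" if "0 < f"
  proof -
    have "2 \<le> level_weight base (level u B 3) - 2 * (k - 1) * real (card (level u B 3))"
      using level_bound(2)[OF level_3_nonempty(1)[OF that]]
        excess_ge_one[of "real_of_int (aff_dim (level u B 3))" "real (card (level u B 3))"] by linarith
    also have "\<dots> \<le> ?\<sigma>"
      by (rule member_le_sum) (use level_bound(1) level_3_nonempty[OF that] in auto)
    finally show ?thesis .
  qed
  show "f \<le> ?\<sigma>" if "k = 2"
    unfolding f_def
  proof (rule sum_mono)
    fix t
    let ?P = "level u B t"
    show "real (card ?P) \<le> level_weight base ?P - 2 * (k - 1) * real (card ?P)"
    proof (cases "?P = {}")
      case True
      then show ?thesis using level_bound(1)[of t] by simp
    next
      case False
      have "aff_dim ?P \<le> aff_dim base" unfolding base_def by (intro aff_dim_subset level_subset)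
      then have "aff_dim ?P \<le> 1" using that unfolding aff_dim_base k_def by linarith
      moreover have "aff_dim ?P \<ge> 0" using False by (simp add: aff_dim_geq aff_dim_negative_iff not_less[symmetric])
      ultimately consider "aff_dim ?P = 0" | "aff_dim ?P = 1" by linarith
      then have "real (card ?P) \<le> 2 * excess (real_of_int (aff_dim ?P)) (real (card ?P))"
      proof cases
        case 1
        then have "card ?P = 1" by (auto simp: aff_dim_eq_0)
        then show ?thesis using excess_ge_one[of "real_of_int (aff_dim ?P)" "real (card ?P)"] by simp
      next
        case 2
        then show ?thesis using excess_one_ge[of "real (card ?P)"] excess_ge_one[of 1 "real (card ?P)"] by simp
      qed
      then show ?thesis using level_bound(2)[OF False] by linarith
    qed
  qed
  have "real (card (sdiff base base)) + real (card (bidiff base multi)) + real (card (sdiff multi multi))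
      + (\<Sum>t\<in>{3..card B}. level_weight base (level u B t)) \<le> D"
    unfolding D_def base_def multi_def by (rule card_sdiff_ge_levels(2)[OF finite_B])
  moreover have "?\<sigma> = (\<Sum>t\<in>{3..card B}. level_weight base (level u B t)) - 2 * (k - 1) * f"
    unfolding f_def by (simp add: sum_subtractf sum_distrib_left)
  ultimately show "(k - 1) * c + excess (k - 1) c + real (card (bidiff base multi)) + j * q + excess j q
      + 2 * (k - 1) * f + ?\<sigma> \<le> D"
    using base_bound multi_bound by linarith
qed

lemma card_sdiff_le_bidiff: "card (sdiff base multi) \<le> card (bidiff base multi)"
  by (rule card_mono) (use finite_base finite_multi in \<open>auto simp: bidiff_def\<close>)

lemma chain_bound:
  obtains \<sigma> where "0 \<le> \<sigma>" "0 < f \<Longrightarrow> 2 \<le> \<sigma>" "k = 2 \<Longrightarrow> f \<le> \<sigma>"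
    "k * m - k + j * (j + 1) / 2 + (k - 2) * f + excess (k - 1) c + excess j q + \<sigma> \<le> D"
proof -
  obtain \<sigma> where \<sigma>: "0 \<le> \<sigma>" "0 < f \<Longrightarrow> 2 \<le> \<sigma>" "k = 2 \<Longrightarrow> f \<le> \<sigma>"
    "(k - 1) * c + excess (k - 1) c + real (card (bidiff base multi)) + j * q + excess j q
      + 2 * (k - 1) * f + \<sigma> \<le> D"
    using two_levels by blast
  have "c + (q - 1) * (k - 1 - j + 1) + j * (j - 1) / 2 \<le> real (card (sdiff base multi))"
    using card_sdiff_ge[OF finite_base base_nonempty finite_multi multi_nonempty]
    by (simp add: c_def q_def j_def k_def aff_dim_base)
  also have "\<dots> \<le> real (card (bidiff base multi))" using card_sdiff_le_bidiff by simp
  finally have "c + (q - 1) * (k - 1 - j + 1) + j * (j - 1) / 2 \<le> real (card (bidiff base multi))" .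
  moreover have "(k - 1) * c + (c + (q - 1) * (k - 1 - j + 1) + j * (j - 1) / 2) + j * q + 2 * (k - 1) * f
     = k * m - k + j * (j + 1) / 2 + (k - 2) * f"
    unfolding c_eq by (simp add: field_simps)
  ultimately show ?thesis using that[of \<sigma>] \<sigma> by linarith
qed

text \<open>Two ways of exploiting a direction \<open>s\<close> joining two points of \<open>multi\<close>: if \<open>base\<close> has many lines
  in direction \<open>s\<close>, then \<open>base - multi\<close> is large; if it has few, then projecting \<open>base\<close> along \<open>s\<close>
  shows that \<open>base - base\<close> is large.\<close>

lemma second_direction:
  assumes "2 \<le> q" "f = 0"
  obtains L where
    "k * m - 2 * k + 1 + L + j * (j + 1) / 2 + excess (k - 1) c + excess j q \<le> D"
    "(k - 2) * (2 * m - L) + 2 * q + 3 + 2 * excess j q \<le> D"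
proof -
  obtain \<sigma> where \<sigma>: "0 \<le> \<sigma>"
    "(k - 1) * c + excess (k - 1) c + real (card (bidiff base multi)) + j * q + excess j q
      + 2 * (k - 1) * f + \<sigma> \<le> D"
    using two_levels by blast
  have "2 \<le> card multi" using assms by (simp add: q_def)
  then obtain s1 s2 where s: "s1 \<in> multi" "s2 \<in> multi" "s1 \<noteq> s2" and
    chain: "c + (q - 1) * (k - 1 - j + 1) + j * (j - 1) / 2 - (k - 1)
      + real (card (line_proj (s1 - s2) ` base)) \<le> real (card (sdiff base multi))"
    using card_sdiff_chain[OF finite_base base_nonempty finite_multi]
    by (auto simp: c_def q_def j_def k_def aff_dim_base)
  define s where "s = s1 - s2"
  define L where "L = real (card (line_proj s ` base))"
  have "line_proj s s1 = line_proj s s2"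
    using line_proj_scaleR[of s 1] by (simp add: s_def line_proj_diff)
  then have "\<not> inj_on (line_proj s) base" using s multi_subset unfolding inj_on_def by blast
  then have lt: "card (line_proj s ` base) < card base"
    by (metis card_image_le eq_card_imp_inj_on finite_base le_neq_implies_less)
  interpret base: line_fibration base s
    by unfold_locales (use finite_base lt lower_dim aff_dim_base in auto)
  have "(k - 2) * L + excess (k - 2) L + 2 * (k - 2) * (c - L) + 2 \<le> real (card (sdiff base base))"
  proof -
    have eqs: "base.k = k - 1" "base.m = c" "base.c = L" "base.D = real (card (sdiff base base))"
      by (simp_all add: base.k_def k_def aff_dim_base base.m_def c_def base.c_def base.base_def L_def base.D_def)
    have "(base.k - 1) * base.c + excess (base.k - 1) base.c + 2 * (base.k - 1) * (base.m - base.c) + 2 \<le> base.D"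
      using base.all_levels base.base_bound excess_ge_one[of base.j base.q] by linarith
    then show ?thesis unfolding eqs by (simp add: algebra_simps)
  qed
  then have "(k - 2) * (2 * c - L) + 3 \<le> real (card (sdiff base base))"
    using excess_ge_one[of "k - 2" L] by (simp add: algebra_simps)
  then have "(k - 2) * (2 * c - L) + 3 + 2 * (k - 1) * (m - c) + 2 * excess j q \<le> D"
    using all_levels by linarith
  moreover have "(k - 2) * (2 * c - L) + 2 * (k - 1) * (m - c) = (k - 2) * (2 * m - L) + 2 * q"
    using assms unfolding c_eq by (simp add: algebra_simps)
  moreover have "c + (q - 1) * (k - 1 - j + 1) + j * (j - 1) / 2 - (k - 1) + L \<le> real (card (bidiff base multi))"
    using chain card_sdiff_le_bidiff unfolding L_def s_def by linarith
  moreover have "(k - 1) * c + (c + (q - 1) * (k - 1 - j + 1) + j * (j - 1) / 2 - (k - 1) + L) + j * q + 2 * (k - 1) * f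
     = k * m - 2 * k + 1 + L + j * (j + 1) / 2"
    using assms(2) unfolding c_eq by (simp add: field_simps)
  ultimately show ?thesis using that[of L] \<sigma> by linarith
qed

end

context line_fibration
begin

lemma excess_multi_ge:
  assumes "2 \<le> k"
  shows "1 + (q - 1) / (2 * k - 3) \<le> excess j q + j * (j + 1) / 2"
proof (cases "j = 0")
  case True
  then show ?thesis using excess_ge_one[of j q] j_zero by simp
next
  case False
  then have j: "1 \<le> j" using j_int by auto
  then have "1 * 2 \<le> j * (j + 1)" by (intro mult_mono) auto
  moreover have "(q - 1) / (2 * (k - 1) - 1) \<le> excess j q"
    by (rule excess_ge_linear') (use j j_bounds q_ge_one in auto)
  ultimately show ?thesis by simp
qed

lemma bound_long_line:
  assumes "3 \<le> k" "1 \<le> f"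
  shows "k * m + (m - 1) / (2 * k - 1) \<le> D"
proof -
  obtain \<sigma> where \<sigma>: "2 \<le> \<sigma>"
    "k * m - k + j * (j + 1) / 2 + (k - 2) * f + excess (k - 1) c + excess j q + \<sigma> \<le> D"
    using chain_bound assms by (metis less_le_trans zero_less_one)
  have "m \<ge> 1" using two_le_card by (simp add: m_def)
  have "(c - 1) / (2 * k - 3) \<le> excess (k - 1) c" using excess_ge_linear[of c "k - 1"] by (simp add: algebra_simps)
  moreover have "1 + (q - 1) / (2 * k - 3) \<le> excess j q + j * (j + 1) / 2" using excess_multi_ge assms by simp
  moreover have "(c - 1) / (2 * k - 3) + (q - 1) / (2 * k - 3) = (m - 1) / (2 * k - 3) - (f + 1) / (2 * k - 3)"
    unfolding c_eq by (simp add: diff_divide_distrib add_divide_distrib)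
  moreover have "(m - 1) / (2 * k - 1) \<le> (m - 1) / (2 * k - 3)"
    using assms \<open>m \<ge> 1\<close> by (intro divide_left_mono mult_pos_pos) auto
  moreover have "(f + 1) / (2 * k - 3) \<le> (f + 1) / 3" using assms by (intro divide_left_mono mult_pos_pos) auto
  moreover have "0 \<le> (k - 3) * (f - 1)" using assms by (intro mult_nonneg_nonneg) auto
  then have "f - 1 + k - 3 + 1 \<le> (k - 2) * f" by (simp add: algebra_simps)
  ultimately show ?thesis using \<sigma> assms by (simp add: add_divide_distrib)
qed

lemma bound_planar:
  assumes "k = 2" "4 \<le> m"
  shows "k * m + (m - 1) / (2 * k - 1) \<le> D"
proof -
  obtain \<sigma> where \<sigma>: "f \<le> \<sigma>"
    "k * m - k + j * (j + 1) / 2 + (k - 2) * f + excess (k - 1) c + excess j q + \<sigma> \<le> D"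
    using chain_bound assms(1) by metis
  have "c - 1 \<le> excess (k - 1) c" using excess_one_ge[of c] assms by simp
  moreover have "q \<le> excess j q + j * (j + 1) / 2" using excess_multi_ge assms by simp
  ultimately have "k * m - k + m - 1 \<le> D" using \<sigma> assms unfolding c_eq by simp
  moreover have "(m - 1) / (2 * k - 1) \<le> m - 3" using assms by simp
  ultimately show ?thesis using assms(1) by linarith
qed

lemma bound_spatial:
  assumes "k = 3" "7 \<le> m" "3 \<le> q" "f = 0"
  shows "k * m + (m - 1) / (2 * k - 1) \<le> D"
proof -
  obtain \<sigma> where \<sigma>: "0 \<le> \<sigma>"
    "k * m - k + j * (j + 1) / 2 + (k - 2) * f + excess (k - 1) c + excess j q + \<sigma> \<le> D"
    using chain_bound by metis
  have c: "c = m - q" using c_eq assms by simp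
  have e: "(m - q - 1) / 3 \<le> excess (k - 1) c" "1 \<le> excess (k - 1) c"
    using excess_ge_linear[of c "k - 1"] excess_ge_one assms c by auto
  consider "j = 1" | "j = 2" using j_int j_bounds j_zero assms by fastforce
  then show ?thesis
  proof cases
    case 1
    have ej: "q - 1 \<le> excess j q" using excess_one_ge 1 by simp
    show ?thesis
    proof (cases "9 \<le> m \<or> 4 \<le> q")
      case True
      then show ?thesis using \<sigma> e ej assms 1 by (auto simp: field_simps)
    next
      case False
      have "(k - 1) * c + excess (k - 1) c + 2 * (k - 1) * (m - c) + 2 * excess j q \<le> D"
        using all_levels base_bound by linarith
      then show ?thesis using False e ej assms c by (simp add: field_simps)
    qed
  next
    case 2
    then have "(q - 1) / 3 \<le> excess j q" using excess_ge_linear[of q j] by simp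
    then show ?thesis using \<sigma> e assms 2 by (simp add: field_simps)
  qed
qed

lemma excess_multi_cases:
  assumes "3 \<le> q"
  obtains "j = 1" "2 \<le> excess j q" "q - 1 \<le> excess j q"
    | "2 \<le> j" "6 \<le> j * (j + 1)" "1 \<le> excess j q"
proof -
  consider "j = 1" | "2 \<le> j" using j_int j_zero assms by fastforce
  then show ?thesis
  proof cases
    case 1
    then show ?thesis using that(1) excess_one_ge[of q] assms by simp
  next
    case 2
    then have "2 * 3 \<le> j * (j + 1)" by (intro mult_mono) auto
    then show ?thesis using that(2) 2 excess_ge_one by simp
  qed
qed

lemma bound_dim_four:
  assumes "k = 4" "9 \<le> m" "3 \<le> q" "f = 0"
  shows "k * m + (m - 1) / (2 * k - 1) \<le> D"
proof -
  obtain \<sigma> where \<sigma>: "0 \<le> \<sigma>"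
    "k * m - k + j * (j + 1) / 2 + (k - 2) * f + excess (k - 1) c + excess j q + \<sigma> \<le> D"
    using chain_bound by metis
  obtain L where L: "k * m - 2 * k + 1 + L + j * (j + 1) / 2 + excess (k - 1) c + excess j q \<le> D"
    "(k - 2) * (2 * m - L) + 2 * q + 3 + 2 * excess j q \<le> D"
    using second_direction assms by auto
  have c: "c = m - q" using c_eq assms by simp
  have e: "(m - q - 1) / 5 \<le> excess (k - 1) c" "1 \<le> excess (k - 1) c"
    using excess_ge_linear[of c "k - 1"] excess_ge_one assms c by auto
  show ?thesis
  proof (cases rule: excess_multi_cases[OF assms(3)])
    case 1
    show ?thesis
    proof (cases "m \<le> 130")
      case True
      then show ?thesis using L e 1 assms by (simp add: field_simps)
    next
      case False
      then show ?thesis using \<sigma> e 1 assms by (simp add: field_simps)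
    qed
  next
    case 2
    have ej: "(q - 1) / 5 \<le> excess j q"
      using excess_ge_linear'[of j 3 q] 2 j_bounds assms by simp
    show ?thesis
    proof (cases "m \<le> 130")
      case True
      then show ?thesis using L e 2 assms by (simp add: field_simps)
    next
      case False
      then show ?thesis using \<sigma> e ej 2 assms by (simp add: field_simps)
    qed
  qed
qed

lemma bound_high_dim:
  assumes "5 \<le> k" "2 * k + 1 \<le> m" "3 \<le> q" "f = 0"
  shows "k * m + (m - 1) / (2 * k - 1) \<le> D"
proof -
  obtain L where L: "k * m - 2 * k + 1 + L + j * (j + 1) / 2 + excess (k - 1) c + excess j q \<le> D"
    "(k - 2) * (2 * m - L) + 2 * q + 3 + 2 * excess j q \<le> D"
    using second_direction assms by auto
  let ?X = "- 2 * k + 1 + j * (j + 1) / 2 + excess (k - 1) c + excess j q"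
  have "(k - 2) * (k * m + L + ?X) \<le> (k - 2) * D"
    using L(1) assms by (intro mult_left_mono) auto
  then have "(k - 2) * k * m + (k - 2) * 2 * m + (k - 2) * ?X + 2 * q + 3 + 2 * excess j q \<le> (k - 1) * D"
    using L(2) by (simp add: algebra_simps)
  moreover have "(k - 1) * ((m - 1) / (2 * k - 1)) \<le> (m - 1) / 2"
  proof -
    have "(k - 1) * (m - 1) / (2 * k - 1) \<le> (m - 1) / 2"
      using assms by (simp add: field_simps)
    then show ?thesis by simp
  qed
  moreover have "(k - 2) * 2 * m + (k - 2) * ?X + 2 * q + 3 + 2 * excess j q - k * m \<ge> (m - 1) / 2"
  proof -
    have "0 \<le> (k - 9/2) * (m - (2 * k + 1))" using assms by (intro mult_nonneg_nonneg) auto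
    then have *: "(k - 4) * m - (m - 1) / 2 \<ge> 2 * k * k - 8 * k - 4" by (simp add: field_simps)
    have "(k - 2) * ?X + 2 * q + 3 + 2 * excess j q \<ge> - 2 * k * k + 8 * k + 4"
    proof (cases rule: excess_multi_cases[OF assms(3)])
      case 1
      then have "- 2 * k + 5 \<le> ?X" using excess_ge_one[of "k - 1" c] by simp
      then have "(k - 2) * (- 2 * k + 5) \<le> (k - 2) * ?X" using assms by (intro mult_left_mono) auto
      then show ?thesis using 1 assms by (simp add: algebra_simps)
    next
      case 2
      then have "- 2 * k + 6 \<le> ?X" using excess_ge_one[of "k - 1" c] by simp
      then have "(k - 2) * (- 2 * k + 6) \<le> (k - 2) * ?X" using assms by (intro mult_left_mono) auto
      then show ?thesis using 2 assms by (simp add: algebra_simps)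
    qed
    then show ?thesis using * by (simp add: algebra_simps)
  qed
  moreover have "(k - 1) * (k * m + p) = (k - 2) * k * m + k * m + (k - 1) * p" for p
    by (simp add: algebra_simps)
  ultimately have "(k - 1) * (k * m + (m - 1) / (2 * k - 1)) \<le> (k - 1) * D" by smt
  then show ?thesis using assms by simp
qed

lemma bound_large:
  assumes "2 \<le> k" "2 * k < m" "3 \<le> q + f"
  shows "k * m + (m - 1) / (2 * k - 1) \<le> D"
proof -
  have "k = 2 \<or> k = 3 \<or> k = 4 \<or> 5 \<le> k"
  proof -
    have "aff_dim B = 2 \<or> aff_dim B = 3 \<or> aff_dim B = 4 \<or> 5 \<le> aff_dim B"
      using assms(1) unfolding k_def by linarith
    then show ?thesis by (auto simp: k_def)
  qed
  have m: "2 * k + 1 \<le> m"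
  proof -
    have "2 * aff_dim B < int (card B)" using assms(2) unfolding k_def m_def by linarith
    then have "2 * aff_dim B + 1 \<le> int (card B)" by simp
    then show ?thesis unfolding k_def m_def by linarith
  qed
  have "f = 0 \<or> 1 \<le> f" 
  proof -
    have "f = real (\<Sum>t\<in>{3..card B}. card (level u B t))" by (simp add: f_def)
    then show ?thesis by (metis of_nat_0 of_nat_1 of_nat_le_iff less_one not_le)
  qed
  then show ?thesis
    using \<open>k = 2 \<or> _\<close> assms m bound_planar bound_spatial bound_dim_four bound_high_dim bound_long_line by auto
qed

lemma bound_small:
  assumes "2 \<le> k" "m \<le> 2 * k" "2 \<le> q + f"
  shows "k * m + 1 \<le> D"
proof -
  have "(k - 1) * c + 1 + 2 * (k - 1) * (m - c) + 2 \<le> D"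
    using all_levels base_bound excess_ge_one[of "k - 1" c] excess_ge_one[of j q] by linarith
  moreover have "(k - 1) * c + 2 * (k - 1) * (m - c) = (k - 1) * m + (k - 1) * (q + f)"
    unfolding c_eq by (simp add: algebra_simps)
  moreover have "(k - 1) * 2 \<le> (k - 1) * (q + f)" using assms by (intro mult_left_mono) auto
  ultimately show ?thesis using assms by (simp add: algebra_simps)
qed

end

text \<open>The bound is sharp for \<open>card B = 2 k\<close>, for example for \<open>T \<union> (v - T)\<close> with \<open>T\<close> a
  simplex on \<open>k\<close> vertices and \<open>v\<close> generic.\<close>

theorem diff_bound_finite:
  fixes B :: "'a::euclidean_space set"
  assumes "finite B" "B \<noteq> {}"
  shows "diff_bound B"
  using assms
proof (induction "nat (aff_dim B)" arbitrary: B rule: less_induct)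
  case less
  define k where "k = real_of_int (aff_dim B)"
  define m where "m = real (card B)"
  define D where "D = real (card (sdiff B B))"
  have dim0: "0 \<le> aff_dim B" using less.prems by (simp add: aff_dim_geq aff_dim_negative_iff not_less[symmetric])
  have lower: "diff_bound S" if "finite S" "S \<noteq> {}" "aff_dim S < aff_dim B" for S :: "'a set"
  proof -
    have "0 \<le> aff_dim S" using that by (simp add: aff_dim_geq aff_dim_negative_iff not_less[symmetric])
    then show ?thesis using less.hyps[of S] that by auto
  qed
  have km: "k + 1 \<le> m" using aff_dim_le_card[OF less.prems(1)] unfolding k_def m_def by linarith
  have goal: "diff_bound B" if "k * m + excess k m \<le> D"
    using that by (simp add: diff_bound_def k_def m_def D_def)
  consider "aff_dim B = 0" | "aff_dim B = 1" | "2 \<le> aff_dim B" using dim0 by linarith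
  then show ?case
  proof cases
    case 1
    then obtain a where "B = {a}" by (auto simp: aff_dim_eq_0)
    then show ?thesis using card_sdiff_sing[of "{a}" a] by (simp add: diff_bound_def excess_def)
  next
    case 2
    have "m + (m - 1) * (k - k + 1) + k * (k - 1) / 2 \<le> D"
      using card_sdiff_ge[of B B] less.prems unfolding m_def k_def D_def by simp
    moreover have "excess k m = m - 1" using km 2 by (simp add: excess_def k_def)
    ultimately show ?thesis using 2 by (intro goal) (simp add: k_def)
  next
    case 3
    then have k2: "2 \<le> k" by (simp add: k_def)
    then have m2: "2 \<le> card B" using km unfolding m_def by linarith
    have fib: "line_fibration B u \<and> card (line_proj u ` B) + R < card B" if "u \<noteq> 0" "R < card {b\<in>B. b + u \<in> B}" for u R
    proof -
      have "card (line_proj u ` B) + R < card B"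
        using card_translates_le[OF less.prems(1) that(1)] that(2) by linarith
      then show ?thesis using less.prems lower by (auto intro!: line_fibration.intro)
    qed
    show ?thesis
    proof (cases "m \<le> 2 * k")
      case True
      then have ex: "excess k m = 1" using k2 by (simp add: excess_def)
      show ?thesis
      proof (cases "D - 1 < m * (m - 1)")
        case True
        then have "real 1 * (real (card (sdiff B B)) - 1) + 1 < real (card B) * (real (card B) - 1) + real 1"
          unfolding D_def m_def by simp
        then obtain u where u: "u \<noteq> 0" "1 < card {b\<in>B. b + u \<in> B}"
          using popular_difference[OF less.prems(1) m2, of 1] by auto
        then interpret L: line_fibration B u using fib by blast
        have eqs: "L.k = k" "L.m = m" "L.D = D" by (simp_all add: L.k_def k_def L.m_def m_def L.D_def D_def)
        have "2 \<le> L.q + L.f" using fib[OF u] L.c_eq unfolding L.c_def L.m_def L.base_def by linarith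
        then have "k * m + 1 \<le> D"
          using L.bound_small k2 \<open>m \<le> 2 * k\<close> unfolding eqs by simp
        then show ?thesis using ex by (intro goal) simp
      next
        case False
        have "(k + 1) * m \<le> m * m" using km k2 by (intro mult_right_mono) auto
        then show ?thesis using False ex by (intro goal) (simp add: algebra_simps)
      qed
    next
      case False
      then have ex: "excess k m = (m - 1) / (2 * k - 1)" using k2 by (simp add: excess_def field_simps)
      show ?thesis
      proof (cases "2 * (D - 1) + 1 < m * (m - 1) + 2")
        case True
        then have "real 2 * (real (card (sdiff B B)) - 1) + 1 < real (card B) * (real (card B) - 1) + real 2"
          unfolding D_def m_def by simp
        then obtain u where u: "u \<noteq> 0" "2 < card {b\<in>B. b + u \<in> B}"
          using popular_difference[OF less.prems(1) m2, of 2] by auto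
        then interpret L: line_fibration B u using fib by blast
        have eqs: "L.k = k" "L.m = m" "L.D = D" by (simp_all add: L.k_def k_def L.m_def m_def L.D_def D_def)
        have "3 \<le> L.q + L.f" using fib[OF u] L.c_eq unfolding L.c_def L.m_def L.base_def by linarith
        then have "k * m + (m - 1) / (2 * k - 1) \<le> D"
          using L.bound_large k2 \<open>\<not> m \<le> 2 * k\<close> unfolding eqs by simp
        then show ?thesis using ex by (intro goal) simp
      next
        case False
        have m1: "2 * k + 1 \<le> m"
        proof -
          have "2 * aff_dim B < int (card B)" using \<open>\<not> m \<le> 2 * k\<close> unfolding k_def m_def by linarith
          then have "2 * aff_dim B + 1 \<le> int (card B)" by simp
          then show ?thesis unfolding k_def m_def by linarith
        qed
        define x where "x = m - (2 * k + 1)"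
        have "(m - 1) / (2 * k - 1) = 1 + (x + 1) / (2 * k - 1)"
          using k2 by (simp add: x_def field_simps)
        moreover have "(x + 1) / (2 * k - 1) \<le> (x + 1) / 3"
          using k2 m1 by (intro divide_left_mono mult_pos_pos) (auto simp: x_def)
        moreover have "5 * x \<le> m * x" using k2 m1 by (intro mult_right_mono) (auto simp: x_def)
        moreover have "m * (m - 1) = 2 * (k * m) + m * x" by (simp add: x_def algebra_simps)
        moreover have "0 \<le> x" using m1 by (simp add: x_def)
        moreover have "2 * (k * m) + m * x + 3 \<le> 2 * D"
          using False \<open>m * (m - 1) = _\<close> by argo
        ultimately have "k * m + (m - 1) / (2 * k - 1) \<le> D" by argo
        then show ?thesis using ex by (intro goal) simp
      qed
    qed
  qed
qed

section \<open>A direction with few lines\<close>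

lemma petridis:
  fixes X A C :: "'a::euclidean_space set"
  assumes "finite X" "finite A" "finite C"
    and minimal: "\<And>Z. Z \<subseteq> X \<Longrightarrow> real (card (sdiff X A)) * real (card Z) \<le> real (card (sdiff Z A)) * real (card X)"
  shows "real (card (sdiff (sdiff X A) C)) * real (card X) \<le> real (card (sdiff X A)) * real (card (sdiff X C))"
  using assms(3)
proof (induction C rule: finite_induct)
  case empty
  show ?case by simp
next
  case (insert c C)
  let ?XA = "sdiff X A"
  define Z where "Z = {x\<in>X. \<forall>a\<in>A. x - a - c \<in> sdiff ?XA C}"
  define W where "W = {x\<in>X. x - c \<in> sdiff X C}"
  have finXA: "finite ?XA" using assms by simp
  have WZ: "W \<subseteq> Z"
  proof
    fix x assume x: "x \<in> W"
    then obtain y d where y: "y \<in> X" "d \<in> C" "x - c = y - d" unfolding W_def by blast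
    have "x - a - c \<in> sdiff ?XA C" if "a \<in> A" for a
    proof -
      have "x - a - c = (y - a) - d" using y(3) by (simp add: algebra_simps)
      then show ?thesis using sdiffI[OF sdiffI[OF y(1) that] y(2)] by metis
    qed
    then show "x \<in> Z" using x by (simp add: Z_def W_def)
  qed
  have "sdiff ?XA (insert c C) \<subseteq> sdiff ?XA C \<union> (\<lambda>y. y - c) ` (?XA - sdiff Z A)"
  proof
    fix y assume "y \<in> sdiff ?XA (insert c C)"
    then obtain z d where z: "z \<in> ?XA" "d \<in> insert c C" "y = z - d" by blast
    show "y \<in> sdiff ?XA C \<union> (\<lambda>y. y - c) ` (?XA - sdiff Z A)"
      using z by (cases "z \<in> sdiff Z A") (auto simp: Z_def elim!: sdiffE)
  qed
  then have "card (sdiff ?XA (insert c C)) \<le> card (sdiff ?XA C \<union> (\<lambda>y. y - c) ` (?XA - sdiff Z A))"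
    using finXA insert by (intro card_mono) auto
  also have "\<dots> \<le> card (sdiff ?XA C) + card ((\<lambda>y. y - c) ` (?XA - sdiff Z A))" by (rule card_Un_le)
  also have "card ((\<lambda>y. y - c) ` (?XA - sdiff Z A)) \<le> card (?XA - sdiff Z A)"
    using finXA by (intro card_image_le) auto
  also have "card (?XA - sdiff Z A) = card ?XA - card (sdiff Z A)"
    by (rule card_Diff_subset) (use assms in \<open>auto simp: Z_def intro: sdiff_mono\<close>)
  finally have 1: "real (card (sdiff ?XA (insert c C))) \<le> real (card (sdiff ?XA C)) + real (card ?XA - card (sdiff Z A))"
    by linarith
  have "card (sdiff Z A) \<le> card ?XA"
    by (rule card_mono[OF finXA], rule sdiff_mono) (auto simp: Z_def)
  then have 2: "real (card (sdiff ?XA (insert c C))) \<le> real (card (sdiff ?XA C)) + real (card ?XA) - real (card (sdiff Z A))"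
    using 1 by linarith
  have "sdiff X (insert c C) = sdiff X C \<union> (\<lambda>x. x - c) ` (X - W)"
    by (auto simp: W_def elim!: sdiffE)
  moreover have "card (sdiff X C \<union> (\<lambda>x. x - c) ` (X - W)) = card (sdiff X C) + card ((\<lambda>x. x - c) ` (X - W))"
    by (rule card_Un_disjoint) (use assms insert in \<open>auto simp: W_def\<close>)
  moreover have "card ((\<lambda>x. x - c) ` (X - W)) = card (X - W)" by (rule card_image) (auto simp: inj_on_def)
  moreover have "card (X - W) = card X - card W" "card W \<le> card X"
    using assms by (auto simp: W_def intro!: card_Diff_subset card_mono)
  then have "real (card (X - W)) = real (card X) - real (card W)" by (simp add: of_nat_diff)
  ultimately have 3: "real (card (sdiff X (insert c C))) = real (card (sdiff X C)) + real (card X) - real (card W)"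
    by simp
  have "real (card ?XA) * real (card W) \<le> real (card ?XA) * real (card Z)"
    using WZ assms by (intro mult_left_mono) (auto simp: Z_def intro!: card_mono)
  also have "\<dots> \<le> real (card (sdiff Z A)) * real (card X)" by (rule minimal) (auto simp: Z_def)
  finally have 4: "real (card ?XA) * real (card W) \<le> real (card (sdiff Z A)) * real (card X)" .
  have "real (card (sdiff ?XA (insert c C))) * real (card X)
      \<le> (real (card (sdiff ?XA C)) + real (card ?XA) - real (card (sdiff Z A))) * real (card X)"
    using 2 by (intro mult_right_mono) auto
  also have "\<dots> \<le> real (card ?XA) * real (card (sdiff X C)) + real (card ?XA) * real (card X)
      - real (card ?XA) * real (card W)"
    using insert.IH 4 by (simp add: algebra_simps)
  also have "\<dots> = real (card ?XA) * real (card (sdiff X (insert c C)))"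
    unfolding 3 by (simp add: algebra_simps)
  finally show ?case .
qed

primrec fold_sum :: "'a::euclidean_space set \<Rightarrow> nat \<Rightarrow> 'a set"
  where "fold_sum A 0 = {0}"
  | "fold_sum A (Suc s) = (\<lambda>(a, b). a + b) ` (A \<times> fold_sum A s)"

lemma finite_fold_sum [simp]: "finite A \<Longrightarrow> finite (fold_sum A s)"
  by (induction s) auto

lemma scaleR_mem_fold_sum: "a \<in> A \<Longrightarrow> real l *\<^sub>R a \<in> fold_sum A l"
proof (induction l)
  case (Suc l)
  then have "(a, real l *\<^sub>R a) \<in> A \<times> fold_sum A l" by simp
  moreover have "real (Suc l) *\<^sub>R a = a + real l *\<^sub>R a" by (simp add: algebra_simps)
  ultimately show ?case by force
qed simp

lemma pluennecke:
  fixes A :: "'a::euclidean_space set"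
  assumes "finite A" "A \<noteq> {}" "real (card (sdiff A A)) \<le> K * real (card A)"
  obtains X where "X \<subseteq> A" "X \<noteq> {}" "\<And>s. real (card (sdiff X (fold_sum A s))) \<le> K ^ s * real (card X)"
proof -
  let ?r = "\<lambda>Z. real (card (sdiff Z A)) / real (card Z)"
  have fin: "finite {Z. Z \<subseteq> A \<and> Z \<noteq> {}}" using assms by simp
  have "{Z. Z \<subseteq> A \<and> Z \<noteq> {}} \<noteq> {}" using assms by blast
  then obtain X where X: "is_arg_min ?r (\<lambda>Z. Z \<in> {Z. Z \<subseteq> A \<and> Z \<noteq> {}}) X"
    using ex_is_arg_min_if_finite[OF fin] by blast
  then have XA: "X \<subseteq> A" "X \<noteq> {}" by (auto simp: is_arg_min_def)
  have finX: "finite X" using XA assms finite_subset by blast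
  have cX: "0 < real (card X)" using XA finX by (simp add: card_gt_0_iff)
  have min: "?r X \<le> ?r Z" if "Z \<subseteq> A" "Z \<noteq> {}" for Z
    using X that unfolding is_arg_min_linorder by blast
  have minimal: "real (card (sdiff X A)) * real (card Z) \<le> real (card (sdiff Z A)) * real (card X)" if "Z \<subseteq> X" for Z
  proof (cases "Z = {}")
    case False
    have "finite Z" using that finX finite_subset by blast
    then have "0 < real (card Z)" using False by (simp add: card_gt_0_iff)
    then show ?thesis using min[of Z] that XA False cX by (simp add: divide_simps)
  qed simp
  have "?r A \<le> K" using assms by (simp add: divide_simps card_gt_0_iff)
  then have XK: "real (card (sdiff X A)) \<le> K * real (card X)"
  proof -
    have "?r X \<le> K" using min[of A] \<open>?r A \<le> K\<close> assms by simp
    then show ?thesis using cX by (simp add: pos_divide_le_eq)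
  qed
  have K: "0 \<le> K" using XK cX by (metis mult_less_0_iff not_le of_nat_0_le_iff order_trans)
  have "real (card (sdiff X (fold_sum A s))) \<le> K ^ s * real (card X)" for s
  proof (induction s)
    case 0
    then show ?case by (simp add: card_sdiff_sing)
  next
    case (Suc s)
    have "sdiff X (fold_sum A (Suc s)) = sdiff (sdiff X A) (fold_sum A s)"
    proof (intro equalityI subsetI)
      fix x assume "x \<in> sdiff X (fold_sum A (Suc s))"
      then obtain y a z where "y \<in> X" "a \<in> A" "z \<in> fold_sum A s" "x = y - (a + z)" by auto
      then show "x \<in> sdiff (sdiff X A) (fold_sum A s)" using sdiffI by (metis diff_diff_eq)
    next
      fix x assume "x \<in> sdiff (sdiff X A) (fold_sum A s)"
      then obtain y a z where x: "y \<in> X" "a \<in> A" "z \<in> fold_sum A s" "x = y - a - z" by blast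
      then have "a + z \<in> fold_sum A (Suc s)" by force
      then show "x \<in> sdiff X (fold_sum A (Suc s))" using x sdiffI by (metis diff_diff_eq)
    qed
    then have "real (card (sdiff X (fold_sum A (Suc s)))) * real (card X)
        \<le> real (card (sdiff X A)) * real (card (sdiff X (fold_sum A s)))"
      using petridis[OF finX assms(1) _ minimal, of "fold_sum A s"] assms by simp
    also have "\<dots> \<le> (K * real (card X)) * (K ^ s * real (card X))"
      using Suc XK K by (intro mult_mono) auto
    finally show ?case using cX by (simp add: algebra_simps)
  qed
  then show ?thesis using that XA by blast
qed

lemma ruzsa_triangle:
  fixes X U V :: "'a::euclidean_space set"
  assumes "finite X" "finite U" "finite V"
  shows "card X * card (sdiff U V) \<le> card (sdiff X U) * card (sdiff X V)"
proof -
  have "\<forall>d\<in>sdiff U V. \<exists>p. fst p \<in> U \<and> snd p \<in> V \<and> d = fst p - snd p" by (auto elim!: sdiffE)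
  then obtain p where p: "\<And>d. d \<in> sdiff U V \<Longrightarrow> fst (p d) \<in> U \<and> snd (p d) \<in> V \<and> d = fst (p d) - snd (p d)"
    by metis
  let ?g = "\<lambda>(x, d). (x - fst (p d), x - snd (p d))"
  have "inj_on ?g (X \<times> sdiff U V)"
  proof (rule inj_onI, clarify)
    fix x d x' d'
    assume d: "d \<in> sdiff U V" "d' \<in> sdiff U V"
      and eq: "x - fst (p d) = x' - fst (p d')" "x - snd (p d) = x' - snd (p d')"
    have "d = (x - snd (p d)) - (x - fst (p d))" using p[OF d(1)] by simp
    also have "\<dots> = (x' - snd (p d')) - (x' - fst (p d'))" by (simp only: eq)
    also have "\<dots> = d'" using p[OF d(2)] by simp
    finally show "x = x' \<and> d = d'" using eq by simp
  qed
  moreover have "?g ` (X \<times> sdiff U V) \<subseteq> sdiff X U \<times> sdiff X V" using p by auto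
  ultimately have "card (X \<times> sdiff U V) \<le> card (sdiff X U \<times> sdiff X V)"
    using assms by (intro card_inj_on_le[of ?g]) auto
  then show ?thesis by (simp add: card_cartesian_product)
qed

lemma ruzsa_covering:
  fixes X U :: "'a::euclidean_space set"
  assumes "finite X" "X \<noteq> {}" "finite U" "real (card (sdiff X U)) \<le> M * real (card X)"
  obtains Y where "finite Y" "real (card Y) \<le> M" "\<And>u. u \<in> U \<Longrightarrow> \<exists>y\<in>Y. u - y \<in> sdiff X X"
proof -
  let ?P = "\<lambda>Y. Y \<subseteq> U \<and> (\<forall>y\<in>Y. \<forall>z\<in>Y. y \<noteq> z \<longrightarrow> y - z \<notin> sdiff X X)"
  have fin: "finite {Y. ?P Y}" by (rule finite_subset[of _ "Pow U"]) (use assms in auto)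
  have ne: "{Y. ?P Y} \<noteq> {}" by blast
  obtain Y where Y: "is_arg_min (\<lambda>Y. - int (card Y)) (\<lambda>Y. Y \<in> {Y. ?P Y}) Y"
    using ex_is_arg_min_if_finite[OF fin ne] by blast
  then have PY: "?P Y" by (simp add: is_arg_min_def)
  have finY: "finite Y" using PY assms finite_subset by blast
  have max: "card Z \<le> card Y" if "?P Z" for Z
    using Y that unfolding is_arg_min_linorder by force
  let ?g = "\<lambda>(x, y). x - y"
  have "inj_on ?g (X \<times> Y)"
  proof (rule inj_onI, clarify)
    fix x y x' y' assume "x \<in> X" "y \<in> Y" "x' \<in> X" "y' \<in> Y" "x - y = x' - y'"
    moreover from this have "y - y' = x - x'" by (simp add: algebra_simps)
    ultimately show "x = x' \<and> y = y'" using PY by (metis diff_add_cancel sdiffI)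
  qed
  then have "card (X \<times> Y) \<le> card (sdiff X U)"
    by (rule card_inj_on_le) (use PY assms in auto)
  then have "real (card X) * real (card Y) \<le> M * real (card X)"
    using assms(4) by (simp add: card_cartesian_product) (metis of_nat_le_iff of_nat_mult order_trans)
  moreover have "0 < real (card X)" using assms by (simp add: card_gt_0_iff)
  ultimately have "real (card Y) \<le> M" by (simp add: mult.commute)
  moreover have "\<exists>y\<in>Y. u - y \<in> sdiff X X" if u: "u \<in> U" for u
  proof (cases "u \<in> Y")
    case True
    obtain x where "x \<in> X" using assms by blast
    then have "u - u \<in> sdiff X X" using sdiffI[of x X x X] by simp
    then show ?thesis using True by blast
  next
    case False
    then have "\<not> ?P (insert u Y)" using max[of "insert u Y"] finY by auto
    then obtain y where y: "y \<in> Y" "u - y \<in> sdiff X X \<or> y - u \<in> sdiff X X" using PY u by blast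
    moreover have "u - y \<in> sdiff X X" if "y - u \<in> sdiff X X"
      using that by (metis minus_diff_eq sdiffE sdiffI)
    ultimately show ?thesis by blast
  qed
  ultimately show ?thesis using that finY by blast
qed

lemma rich_direction:
  fixes K \<gamma> :: real
  assumes "0 < \<gamma>" "1 \<le> K"
  shows "\<exists>n0::nat. \<forall>A :: 'a::euclidean_space set. finite A \<and> n0 \<le> card A
    \<and> real (card (sdiff A A)) \<le> K * real (card A)
    \<longrightarrow> (\<exists>u. real (card (line_proj u ` A)) \<le> \<gamma> * real (card A))"
proof -
  obtain N :: nat where N: "K ^ 5 / \<gamma> \<le> real N" using real_arch_simple by blast
  define M where "M = (\<Prod>l\<in>{..N}. K ^ l)"
  obtain n0 :: nat where n0: "M < real n0" using reals_Archimedean2 by blast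
  have "\<exists>u. real (card (line_proj u ` A)) \<le> \<gamma> * real (card A)"
    if A: "finite A" "n0 \<le> card A" "real (card (sdiff A A)) \<le> K * real (card A)" for A :: "'a set"
  proof -
    have "0 < M" unfolding M_def using assms by (intro prod_pos) auto
    then have cA: "0 < card A" using n0 A(2) by linarith
    then have "A \<noteq> {}" by auto
    then obtain X where X: "X \<subseteq> A" "X \<noteq> {}" "\<And>s. real (card (sdiff X (fold_sum A s))) \<le> K ^ s * real (card X)"
      using pluennecke[OF A(1) _ A(3)] by metis
    have finX: "finite X" using X A finite_subset by blast
    have cX: "0 < real (card X)" using X finX by (simp add: card_gt_0_iff)
    have "\<exists>Y. finite Y \<and> real (card Y) \<le> K ^ l \<and> (\<forall>a\<in>A. \<exists>y\<in>Y. real l *\<^sub>R a - y \<in> sdiff X X)" for l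
    proof -
      obtain Y where "finite Y" "real (card Y) \<le> K ^ l" "\<And>u. u \<in> fold_sum A l \<Longrightarrow> \<exists>y\<in>Y. u - y \<in> sdiff X X"
        using ruzsa_covering[OF finX X(2) _ X(3), of l] A by auto
      then show ?thesis using scaleR_mem_fold_sum by blast
    qed
    then obtain Y where Y: "\<And>l. finite (Y l)" "\<And>l. real (card (Y l)) \<le> K ^ l"
      "\<And>l a. a \<in> A \<Longrightarrow> \<exists>y\<in>Y l. real l *\<^sub>R a - y \<in> sdiff X X"
      by metis
    then obtain col where col: "\<And>l a. a \<in> A \<Longrightarrow> col a l \<in> Y l \<and> real l *\<^sub>R a - col a l \<in> sdiff X X"
      by metis
    let ?c = "\<lambda>a. restrict (col a) {..N}"
    have "?c ` A \<subseteq> PiE {..N} Y"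
      by (intro image_subsetI restrict_PiE_iff[THEN iffD2] ballI col[THEN conjunct1])
    then have "real (card (?c ` A)) \<le> real (card (PiE {..N} Y))"
      using Y(1) by (intro of_nat_mono card_mono finite_PiE) auto
    also have "\<dots> = (\<Prod>l\<in>{..N}. real (card (Y l)))" by (simp add: card_PiE)
    also have "\<dots> \<le> M" unfolding M_def using Y(2) by (intro prod_mono) auto
    finally have "card (?c ` A) < card A" using n0 A(2) by linarith
    then have "\<not> inj_on ?c A" by (auto dest: card_image)
    then obtain a a' where aa: "a \<in> A" "a' \<in> A" "a \<noteq> a'" "?c a = ?c a'" unfolding inj_on_def by blast
    define u where "u = a - a'"
    have u0: "u \<noteq> 0" using aa by (simp add: u_def)
    let ?S = "sdiff (fold_sum A 3) (fold_sum A 2)"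
    have mem: "b + real l *\<^sub>R u \<in> ?S" if "b \<in> A" "l \<le> N" for b l
    proof -
      have "col a l = col a' l" using aa(4) that(2) by (metis atMost_iff restrict_apply')
      then have "real l *\<^sub>R u = (real l *\<^sub>R a - col a l) - (real l *\<^sub>R a' - col a' l)"
        by (simp add: u_def algebra_simps)
      moreover obtain x1 x2 where x: "x1 \<in> X" "x2 \<in> X" "real l *\<^sub>R a - col a l = x1 - x2" using col[OF aa(1)] by blast
      moreover obtain x3 x4 where y: "x3 \<in> X" "x4 \<in> X" "real l *\<^sub>R a' - col a' l = x3 - x4" using col[OF aa(2)] by blast
      ultimately have "b + real l *\<^sub>R u = (b + (x1 + (x4 + 0))) - (x2 + (x3 + 0))" by (simp add: algebra_simps)
      moreover have "b + (x1 + (x4 + 0)) \<in> fold_sum A 3" "x2 + (x3 + 0) \<in> fold_sum A 2"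
        using x y X(1) that(1) by (auto simp: numeral_3_eq_3 numeral_2_eq_2 image_iff)
      ultimately show ?thesis using sdiffI by metis
    qed
    obtain R where R: "R \<subseteq> A" "inj_on (line_proj u) R" "line_proj u ` A = line_proj u ` R"
      using subset_image_inj[of "line_proj u ` A" "line_proj u" A] by auto
    let ?g = "\<lambda>(b, l). b + real l *\<^sub>R u"
    have proj: "line_proj u (b + real l *\<^sub>R u) = line_proj u b" for b l
      by (simp add: linear_add[OF linear_line_proj] line_proj_scaleR)
    have "inj_on ?g (R \<times> {..N})"
    proof (rule inj_onI, clarify)
      fix b l b' l' assume "b \<in> R" "b' \<in> R" and eq: "b + real l *\<^sub>R u = b' + real l' *\<^sub>R u"
      moreover from eq have "line_proj u b = line_proj u b'" by (metis proj)
      ultimately have "b = b'" using R(2) by (auto dest: inj_onD)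
      then show "b = b' \<and> l = l'" using eq u0 by simp
    qed
    moreover have "?g ` (R \<times> {..N}) \<subseteq> ?S" using mem R(1) by auto
    ultimately have "card (R \<times> {..N}) \<le> card ?S" using A by (intro card_inj_on_le[of ?g]) auto
    then have "real (card R * (N + 1)) \<le> real (card ?S)" by (simp add: card_cartesian_product del: of_nat_mult)
    then have S: "real (card R) * real (N + 1) \<le> real (card ?S)" by (simp only: of_nat_mult)
    have "real (card X) * real (card ?S) \<le> real (card (sdiff X (fold_sum A 3))) * real (card (sdiff X (fold_sum A 2)))"
      using ruzsa_triangle[OF finX, of "fold_sum A 3" "fold_sum A 2"] A by (simp flip: of_nat_mult)
    also have "\<dots> \<le> (K ^ 3 * real (card X)) * (K ^ 2 * real (card X))"
      using X(3) assms by (intro mult_mono) auto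
    also have "\<dots> = real (card X) * (K ^ 5 * real (card X))" by (simp add: power_numeral_reduce)
    finally have "real (card ?S) \<le> K ^ 5 * real (card X)" using cX by simp
    also have "\<dots> \<le> K ^ 5 * real (card A)"
      using assms X(1) A(1) by (intro mult_left_mono) (auto intro: card_mono)
    also have "\<dots> \<le> \<gamma> * real (N + 1) * real (card A)"
    proof (rule mult_right_mono)
      have "K ^ 5 \<le> \<gamma> * real N" using N assms by (simp add: field_simps)
      then show "K ^ 5 \<le> \<gamma> * real (N + 1)" using assms by (simp add: algebra_simps)
    qed simp
    finally have "real (card R) * real (N + 1) \<le> (\<gamma> * real (card A)) * real (N + 1)"
      using S by (simp add: algebra_simps)
    then have "real (card R) \<le> \<gamma> * real (card A)" by (rule mult_right_le_imp_le) simp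
    moreover have "card (line_proj u ` A) = card R" using R by (simp add: card_image)
    ultimately show ?thesis by metis
  qed
  then show ?thesis by blast
qed

section \<open>Large difference sets\<close>

lemma excess_ge_ratio:
  assumes "1 \<le> k"
  shows "m / (2 * k) \<le> excess k m"
proof (cases "m \<le> 2 * k")
  case True
  then have "m / (2 * k) \<le> 1" using assms by simp
  then show ?thesis using excess_ge_one[of k m] by linarith
next
  case False
  then have "m / (2 * k) \<le> (m - 1) / (2 * k - 1)" using assms by (simp add: field_simps)
  then show ?thesis using excess_ge_linear[of m k] by linarith
qed

context
  fixes B P :: "'a::euclidean_space set" and k p :: real
  assumes finite_B: "finite B" and P: "P \<subseteq> B" "P \<noteq> {}"
    and dim: "1 \<le> aff_dim B"
  defines "k \<equiv> real_of_int (aff_dim B)" and "p \<equiv> real (card P)"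
begin

lemma diff_bound_P: "diff_bound P"
  using P finite_B finite_subset by (intro diff_bound_finite) auto

lemma aff_dim_P_cases:
  obtains "aff_dim P = 0" "p = 1" | "1 \<le> aff_dim P" "aff_dim P < aff_dim B" | "aff_dim P = aff_dim B"
proof -
  have "0 \<le> aff_dim P" using P by (simp add: aff_dim_geq aff_dim_negative_iff not_less[symmetric])
  moreover have "aff_dim P \<le> aff_dim B" by (rule aff_dim_subset[OF P(1)])
  moreover have "p = 1" if "aff_dim P = 0" using that by (auto simp: aff_dim_eq_0 p_def)
  ultimately show ?thesis using that by linarith
qed

lemma level_weight_ge_extremal: "(2 * k + 1 / k) * p \<le> level_weight B P"
proof -
  have k: "1 \<le> k" using dim by (simp add: k_def)
  have p: "0 \<le> p" by (simp add: p_def)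
  have "p / k \<le> 2 * excess (real_of_int (aff_dim P)) p"
  proof (cases rule: aff_dim_P_cases)
    case 1
    then have "p / k \<le> 1" using k by simp
    then show ?thesis using excess_ge_one[of "real_of_int (aff_dim P)" p] by simp
  next
    case 2
    then have "p / k \<le> p / real_of_int (aff_dim P)"
      using p k by (intro divide_left_mono) (auto simp: k_def)
    then show ?thesis using excess_ge_ratio[of "real_of_int (aff_dim P)" p] 2 by simp
  next
    case 3
    then show ?thesis using excess_ge_ratio[of k p] k by (simp add: k_def)
  qed
  then show ?thesis using level_weight_ge[OF diff_bound_P, of B] by (simp add: k_def p_def algebra_simps)
qed

lemma bonus_extremal:
  assumes "2 * k < real (card B)" "aff_dim P = aff_dim B" "p = 2 * k" "real (card (sdiff P P)) \<le> 2 * k\<^sup>2 + 1"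
  shows "bonus B P = 1"
proof -
  have "\<exists>q\<in>P. b - q \<notin> sdiff P P" if b: "b \<in> B - P" for b
  proof (rule ccontr)
    assume "\<not> ?thesis"
    then have in1: "b - q \<in> sdiff P P" if "q \<in> P" for q using that by blast
    then have in2: "q - b \<in> sdiff P P" if "q \<in> P" for q
      using that by (metis minus_diff_eq sdiffE sdiffI)
    obtain q where "q \<in> P" using P by blast
    then have in0: "b - b \<in> sdiff P P" using sdiffI[of q P q P] by simp
    have "sdiff (insert b P) (insert b P) \<subseteq> sdiff P P"
    proof
      fix x assume "x \<in> sdiff (insert b P) (insert b P)"
      then obtain y z where "y \<in> insert b P" "z \<in> insert b P" "x = y - z" by blast
      then show "x \<in> sdiff P P" using in0 in1 in2 by auto
    qed
    have finP: "finite P" using P finite_B finite_subset by blast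
    have "card (sdiff (insert b P) (insert b P)) \<le> card (sdiff P P)"
      by (rule card_mono) (use finP \<open>sdiff (insert b P) (insert b P) \<subseteq> sdiff P P\<close> in auto)
    moreover have "aff_dim (insert b P) = aff_dim B"
      using aff_dim_subset[OF subset_insertI[of P b]] aff_dim_subset[of "insert b P" B] P b assms(2) by auto
    moreover have "real (card (insert b P)) = 2 * k + 1" using b finP assms(3) by (simp add: p_def)
    moreover have "diff_bound (insert b P)" using finP by (intro diff_bound_finite) auto
    ultimately have "k * (2 * k + 1) + 1 \<le> real (card (sdiff P P))"
      using excess_ge_one[of k "2 * k + 1"] unfolding diff_bound_def k_def by simp
    then show False using assms(4) dim by (simp add: k_def power2_eq_square algebra_simps)
  qed
  moreover have "P \<noteq> B" using assms(1,3) by (auto simp: p_def)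
  ultimately show ?thesis using assms(2) by (simp add: bonus_def)
qed

lemma level_weight_ge_strict:
  assumes large: "2 * k < real (card B)"
  shows "(2 * k + 1 / k + 1 / (4 * k ^ 3)) * p \<le> level_weight B P"
proof -
  define c where "c = 1 / (4 * k ^ 3)"
  define j where "j = real_of_int (aff_dim P)"
  have k: "1 \<le> k" using dim by (simp add: k_def)
  have "finite P" using P finite_B finite_subset by blast
  then have p: "1 \<le> p" using P by (simp add: p_def Suc_le_eq card_gt_0_iff)
  have c0: "0 < c" using k by (simp add: c_def)
  have ck: "c * (4 * k ^ 3) = 1" using k by (simp add: c_def)
  have ck2: "4 * c \<le> 1 / k ^ 2"
    using k by (simp add: c_def field_simps power2_eq_square power3_eq_cube)
  have k2: "1 \<le> k ^ 2" using k by simp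
  have lw: "2 * k * p + 2 * excess j p \<le> level_weight B P"
    using level_weight_ge[OF diff_bound_P, of B] by (simp add: k_def p_def j_def)
  have "(1 / k + c) * p + 2 * k * p \<le> level_weight B P"
  proof (cases rule: aff_dim_P_cases)
    case 1
    have "1 / k ^ 2 \<le> 1" "1 / k \<le> 1" using k k2 by (simp_all add: divide_le_eq)
    then have "1 / k + c \<le> 2" using ck2 by linarith
    then show ?thesis using lw 1 excess_ge_one[of j p] by simp
  next
    case 2
    then have j: "1 \<le> j" "j \<le> k - 1" by (simp_all add: j_def k_def)
    have "1 / k + c \<le> 1 / (k - 1)"
    proof -
      have "1 / k ^ 2 \<le> 1 / (k * (k - 1))"
        using j by (simp add: field_simps power2_eq_square)
      also have "\<dots> = 1 / (k - 1) - 1 / k" using j by (simp add: field_simps)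
      finally show ?thesis using ck2 c0 by simp
    qed
    also have "\<dots> \<le> 1 / j" using j by (intro divide_left_mono) auto
    finally have "(1 / k + c) * p \<le> (1 / j) * p" using p by (intro mult_right_mono) auto
    then show ?thesis using lw excess_ge_ratio[of j p] j by simp
  next
    case 3
    then have j: "j = k" by (simp add: j_def k_def)
    have pint: "p \<le> 2 * k - 1 \<or> p = 2 * k \<or> 2 * k + 1 \<le> p"
    proof -
      have "int (card P) \<le> 2 * aff_dim B - 1 \<or> int (card P) = 2 * aff_dim B \<or> 2 * aff_dim B + 1 \<le> int (card P)"
        by linarith
      then show ?thesis
      proof (elim disjE)
        assume "int (card P) \<le> 2 * aff_dim B - 1"
        then show ?thesis unfolding p_def k_def by linarith
      next
        assume "int (card P) = 2 * aff_dim B"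
        then show ?thesis unfolding p_def k_def by linarith
      next
        assume "2 * aff_dim B + 1 \<le> int (card P)"
        then show ?thesis unfolding p_def k_def by linarith
      qed
    qed
    have kc: "2 * k * c \<le> 1 / (2 * k)"
      using ck2 k by (simp add: field_simps power2_eq_square)
    have kh: "1 / (2 * k) \<le> 1 / 2" using k by simp
    from pint show ?thesis
    proof (elim disjE)
      assume "p \<le> 2 * k - 1"
      then have "(1 / k + c) * p \<le> (1 / k + c) * (2 * k - 1)"
        using k c0 by (intro mult_left_mono) auto
      also have "\<dots> = 2 - 1 / k + 2 * k * c - c" using k by (simp add: field_simps)
      also have "\<dots> \<le> 2"
      proof -
        have "1 / (2 * k) \<le> 1 / k" using k by (simp add: field_simps)
        then show ?thesis using kc c0 by argo
      qed
      finally show ?thesis using lw excess_ge_one[of j p] by simp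
    next
      assume p2: "p = 2 * k"
      have e: "(1 / k + c) * p = 2 + 2 * k * c" using k p2 by (simp add: field_simps)
      have lwd: "level_weight B P = 2 * real (card (sdiff P P)) + bonus B P"
        using 3 by (simp add: level_weight_def)
      show ?thesis
      proof (cases "real (card (sdiff P P)) \<le> 2 * k\<^sup>2 + 1")
        case True
        have "bonus B P = 1" by (rule bonus_extremal[OF large 3 p2 True])
        moreover have "k * p + 1 \<le> real (card (sdiff P P))"
          using diff_bound_P excess_ge_one[of k p] 3 unfolding diff_bound_def k_def p_def by simp
        ultimately show ?thesis using e lwd kc kh p2 by simp
      next
        case False
        have "2 * k\<^sup>2 + 2 \<le> real (card (sdiff P P))"
        proof -
          have "\<not> int (card (sdiff P P)) \<le> 2 * (aff_dim B)\<^sup>2 + 1"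
          proof
            assume "int (card (sdiff P P)) \<le> 2 * (aff_dim B)\<^sup>2 + 1"
            then have "real_of_int (int (card (sdiff P P))) \<le> real_of_int (2 * (aff_dim B)\<^sup>2 + 1)"
              by (simp only: of_int_le_iff)
            then show False using False by (simp add: k_def)
          qed
          then have "2 * (aff_dim B)\<^sup>2 + 2 \<le> int (card (sdiff P P))" by simp
          then have "real_of_int (2 * (aff_dim B)\<^sup>2 + 2) \<le> real_of_int (int (card (sdiff P P)))"
            by (simp only: of_int_le_iff)
          then show ?thesis by (simp add: k_def)
        qed
        then show ?thesis using e lwd kc kh p2 bonus_bounds(1)[of B P] by (simp add: power2_eq_square)
      qed
    next
      assume p3: "2 * k + 1 \<le> p"
      have "c * p \<le> (p - 2 * k) / (k * (2 * k - 1))"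
      proof -
        have a: "p \<le> (2 * k + 1) * (p - 2 * k)"
        proof -
          have "0 \<le> 2 * k * (p - (2 * k + 1))" using k p3 by (intro mult_nonneg_nonneg) auto
          then show ?thesis by (simp add: algebra_simps)
        qed
        have b: "c * (2 * k + 1) \<le> 1 / (k * (2 * k - 1))"
        proof -
          have "(2 * k + 1) * (k * (2 * k - 1)) \<le> 4 * k ^ 3"
            using k by (simp add: algebra_simps power3_eq_cube)
          then have "c * ((2 * k + 1) * (k * (2 * k - 1))) \<le> c * (4 * k ^ 3)"
            using c0 by (intro mult_left_mono) auto
          then have "c * (2 * k + 1) * (k * (2 * k - 1)) \<le> 1" using ck by (simp add: mult.assoc)
          moreover have "0 < k * (2 * k - 1)" using k by simp
          ultimately show ?thesis by (simp add: pos_le_divide_eq)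
        qed
        have "c * p \<le> c * ((2 * k + 1) * (p - 2 * k))" using a c0 by (intro mult_left_mono) auto
        also have "\<dots> = (c * (2 * k + 1)) * (p - 2 * k)" by simp
        also have "\<dots> \<le> 1 / (k * (2 * k - 1)) * (p - 2 * k)" using b p3 by (intro mult_right_mono) auto
        finally show ?thesis by simp
      qed
      also have "\<dots> = 2 * ((p - 1) / (2 * k - 1)) - p / k" using k by (simp add: field_simps)
      finally have "(1 / k + c) * p \<le> 2 * ((p - 1) / (2 * k - 1))" by (simp add: algebra_simps)
      then show ?thesis using lw excess_ge_linear[of p k] unfolding j by linarith
    qed
  qed
  then show ?thesis by (simp add: c_def algebra_simps)
qed

end

theorem difference_set_lower_bound:
  assumes k: "(1::int) \<le> k"
  shows "\<exists>n0::nat. \<forall>A :: 'a::euclidean_space set. finite A \<and> aff_dim A = k + 1 \<and> n0 \<le> card A \<longrightarrow>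
    (2 * real_of_int k + 1 / real_of_int k) * real (card A) - (2 * (real_of_int k)\<^sup>2 + 1) \<le> real (card (sdiff A A))"
proof -
  define K where "K = real_of_int k"
  have K: "1 \<le> K" using k by (simp add: K_def)
  define c where "c = 1 / (4 * K ^ 3)"
  have c: "0 < c" using K by (simp add: c_def)
  define \<gamma> where "\<gamma> = c / (2 * K + 1 / K + c)"
  have pos: "0 < 2 * K + 1 / K" using K by (simp add: add_pos_pos)
  have \<gamma>: "0 < \<gamma>" "\<gamma> < 1" using c pos by (simp_all add: \<gamma>_def)
  obtain n0 where n0: "\<And>A :: 'a set. finite A \<Longrightarrow> n0 \<le> card A \<Longrightarrow> real (card (sdiff A A)) \<le> (2 * K + 1) * real (card A)
    \<Longrightarrow> \<exists>u. real (card (line_proj u ` A)) \<le> \<gamma> * real (card A)"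
    using rich_direction[of \<gamma> "2 * K + 1"] \<gamma> K by auto
  have "(2 * K + 1 / K) * real (card A) - (2 * K\<^sup>2 + 1) \<le> real (card (sdiff A A))"
    if A: "finite A" "aff_dim A = k + 1" "n0 \<le> card A" for A :: "'a set"
  proof (rule ccontr)
    let ?n = "real (card A)" and ?D = "real (card (sdiff A A))"
    assume "\<not> ?thesis"
    then have small: "?D < (2 * K + 1 / K) * ?n - (2 * K\<^sup>2 + 1)" by simp
    have "1 / K * ?n \<le> 1 * ?n" using K by (intro mult_right_mono) auto
    moreover have "0 \<le> K\<^sup>2" by simp
    moreover have "(2 * K + 1 / K) * ?n = 2 * K * ?n + 1 / K * ?n" "(2 * K + 1) * ?n = 2 * K * ?n + 1 * ?n"
      by (simp_all only: distrib_right)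
    ultimately have "?D \<le> (2 * K + 1) * ?n" using small by linarith
    then obtain u where u: "real (card (line_proj u ` A)) \<le> \<gamma> * ?n" using n0 A by blast
    define B where "B = line_proj u ` A"
    define m where "m = real (card B)"
    have "A \<noteq> {}" using A k by auto
    then have "0 < ?n" using A by (simp add: card_gt_0_iff)
    then have "\<gamma> * ?n < 1 * ?n" using \<gamma> by (intro mult_strict_right_mono) auto
    then have "card (line_proj u ` A) < card A" using u by linarith
    then have "\<not> inj_on (line_proj u) A" by (auto dest: card_image)
    then have dimB: "aff_dim B = k" unfolding inj_on_def B_def using aff_dim_line_proj A(2) by (metis add_diff_cancel_right')
    have finB: "finite B" using A by (simp add: B_def)
    have lower: "g * (?n - m) \<le> (\<Sum>t\<in>{2..card A}. level_weight B (level u A t))"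
      if g: "\<And>P. P \<subseteq> B \<Longrightarrow> P \<noteq> {} \<Longrightarrow> g * real (card P) \<le> level_weight B P" for g
    proof -
      have "(\<Sum>t\<in>{2..card A}. card (level u A t)) + card B = card A"
        unfolding B_def by (rule sum_card_level[OF A(1)])
      then have "(\<Sum>t\<in>{2..card A}. real (card (level u A t))) = ?n - m"
        unfolding m_def by (metis add_diff_cancel_right' of_nat_add of_nat_sum)
      then have "g * (?n - m) = (\<Sum>t\<in>{2..card A}. g * real (card (level u A t)))"
        by (simp flip: sum_distrib_left)
      also have "\<dots> \<le> (\<Sum>t\<in>{2..card A}. level_weight B (level u A t))"
      proof (rule sum_mono)
        fix t
        show "g * real (card (level u A t)) \<le> level_weight B (level u A t)"
        proof (cases "level u A t = {}")
          case True
          then show ?thesis using bonus_bounds(1)[of B "{}"] by (simp add: level_weight_def)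
        next
          case False
          then show ?thesis using g level_subset[of u A t] by (simp add: B_def)
        qed
      qed
      finally show ?thesis .
    qed
    have main: "real (card (sdiff B B)) + (\<Sum>t\<in>{2..card A}. level_weight B (level u A t)) \<le> ?D"
      unfolding B_def by (rule card_sdiff_ge_levels(1)[OF A(1)])
    show False
    proof (cases "m \<le> 2 * K")
      case True
      have "B \<noteq> {}" using \<open>A \<noteq> {}\<close> by (simp add: B_def)
      then have "K * m + excess K m \<le> real (card (sdiff B B))"
        using diff_bound_finite[OF finB] by (simp add: diff_bound_def dimB K_def m_def)
      then have h1: "K * m + m / (2 * K) \<le> real (card (sdiff B B))"
        using excess_ge_ratio[OF K, of m] by linarith
      have h2: "(2 * K + 1 / K) * (?n - m) \<le> (\<Sum>t\<in>{2..card A}. level_weight B (level u A t))"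
        by (rule lower) (use level_weight_ge_extremal[OF finB] dimB k in \<open>simp add: K_def\<close>)
      have "(K + 1 / (2 * K)) * m \<le> (K + 1 / (2 * K)) * (2 * K)"
        using True K by (intro mult_left_mono) auto
      also have "\<dots> = 2 * K\<^sup>2 + 1" using K by (simp add: field_simps power2_eq_square)
      finally have h3: "(K + 1 / (2 * K)) * m \<le> 2 * K\<^sup>2 + 1" .
      have "(2 * K + 1 / K) * ?n - (K + 1 / (2 * K)) * m = (K * m + m / (2 * K)) + (2 * K + 1 / K) * (?n - m)"
        using K by (simp add: field_simps)
      also have "\<dots> \<le> ?D" using add_mono[OF h1 h2] main by (rule order_trans)
      finally show False using small h3 by simp
    next
      case False
      have "(2 * K + 1 / K + c) * (?n - m) \<le> (\<Sum>t\<in>{2..card A}. level_weight B (level u A t))"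
        by (rule lower) (use level_weight_ge_strict[OF finB] dimB k False in \<open>simp add: K_def m_def c_def\<close>)
      moreover have "(2 * K + 1 / K + c) * m \<le> c * ?n"
      proof -
        have "(2 * K + 1 / K + c) * m \<le> (2 * K + 1 / K + c) * (\<gamma> * ?n)"
          using u pos c by (intro mult_left_mono) (auto simp: m_def B_def)
        also have "\<dots> = c * ?n" using pos c by (simp add: \<gamma>_def)
        finally show ?thesis .
      qed
      moreover have "(2 * K + 1 / K + c) * (?n - m) = (2 * K + 1 / K) * ?n + c * ?n - (2 * K + 1 / K + c) * m"
        by (simp add: algebra_simps)
      moreover have "0 \<le> K\<^sup>2" "0 \<le> real (card (sdiff B B))" by simp_all
      ultimately show False using small main by linarith
    qed
  qed
  then show ?thesis unfolding K_def by blast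
qed

theorem theorem1p2:
  fixes d :: nat
  assumes "d = CARD('n::finite)" and "d \<ge> 2"
  shows "\<exists>n0::nat. \<forall>A :: (real ^ 'n) set.
    finite A \<and> aff_dim A = int d \<and> card A \<ge> n0 \<longrightarrow>
      real (card (difference_set A)) \<ge>
        (2 * real d - 2 + 1 / (real d - 1)) * real (card A)
          - (2 * real d ^ 2 - 4 * real d + 3)"
proof -
  have "1 \<le> int d - 1" using assms by simp
  then obtain n0 where n0: "\<And>A :: (real ^ 'n) set. finite A \<Longrightarrow> aff_dim A = int d - 1 + 1 \<Longrightarrow> n0 \<le> card A \<Longrightarrow>
    (2 * real_of_int (int d - 1) + 1 / real_of_int (int d - 1)) * real (card A)
      - (2 * (real_of_int (int d - 1))\<^sup>2 + 1) \<le> real (card (sdiff A A))"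
    using difference_set_lower_bound by metis
  have 1: "real_of_int (int d - 1) = real d - 1" by simp
  have 2: "2 * (real d - 1) = 2 * real d - 2" by simp
  have 3: "2 * (real d - 1)\<^sup>2 + 1 = 2 * real d ^ 2 - 4 * real d + 3"
    by (simp add: power2_eq_square algebra_simps)
  have 4: "int d - 1 + 1 = int d" by simp
  show ?thesis
    unfolding difference_set_eq_sdiff using n0[unfolded 1 3 4, unfolded 2] by blast
qed

end
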